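(* Let $n\ge1$, let $\lambda\in\mathbb{Z}^n$ with $\lambda_1\ge\cdots\ge\lambda_n$, and let $\rho=(n-1,n-2,\ldots,1,0)$. Then $$P_\lambda=\frac{t^{\frac12\ell(w_0)}}{W_\lambda(t)}\,\mathbf{1}_0E_\lambda\qquad\text{and}\qquad A_{\lambda+\rho}=t^{\frac12\ell(w_0)}\,\varepsilon_0E_{\lambda+\rho},$$ where $W_\lambda(t)$ is the normalizing constant which makes the coefficient of $x^\lambda$ in $P_\lambda$ equal to $1$.
   Context: Let $q,t^{1/2}$ be independent indeterminates over $\mathbb{C}$, $t=(t^{1/2})^2$, $K=\mathbb{C}(q,t^{1/2})$, $K[X]=K[x_1^{\pm1},\ldots,x_n^{\pm1}]$. $S_n$ acts on $K[X]$ by permuting variables and on $\mathbb{Z}^n$ by $(w\mu)_{w(i)}=\mu_i$; $s_i=(i,i+1)$; $\ell$ is the length; $w_0$ the longest element; $x^\mu=x_1^{\mu_1}\cdots x_n^{\mu_n}$; $\partial_if=\frac{f-s_if}{x_i-x_{i+1}}$. For $\mu\in\mathbb{Z}^n$, $v_\mu\in S_n$ is the minimal length permutation such that $v_\mu\mu$ is weakly increasing; explicitly $v_\mu(r)=1+\#\{r'<r:\mu_{r'}\le\mu_r\}+\#\{r'>r:\mu_{r'}<\mu_r\}$. The electronic (nonsymmetric) Macdonald polynomials $E_\mu\in K[X]$ are determined by: (E0) $E_{(0,\ldots,0)}=1$; (E1) $E_{(\mu_n+1,\mu_1,\ldots,\mu_{n-1})}=q^{\mu_n}x_1E_\mu(x_2,\ldots,x_n,q^{-1}x_1)$;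 (E2) if $\mu\in\mathbb{Z}_{\ge0}^n$ and $\mu_i>\mu_{i+1}$ then $E_{s_i\mu}=\partial_i(x_iE_\mu)-tx_i\partial_iE_\mu+\frac{(1-t)a}{1-a}E_\mu$ with $a=q^{\mu_i-\mu_{i+1}}t^{v_\mu(i)-v_\mu(i+1)}$; (E3) $E_{(\mu_1-1,\ldots,\mu_n-1)}=x_1^{-1}\cdots x_n^{-1}E_\mu$. The bosonic and fermionic Macdonald polynomials are defined by $$P_\lambda=\frac1{W_\lambda(t)}\sum_{w\in S_n}w\Big(E_\lambda\prod_{i<j}\frac{x_i-tx_j}{x_i-x_j}\Big),\qquad A_{\lambda+\rho}=\Big(\prod_{i<j}\frac{x_j-tx_i}{x_i-x_j}\Big)\sum_{w\in S_n}(-1)^{\ell(w)}wE_{\lambda+\rho},$$ with $W_\lambda(t)$ as in the claim. The Hecke operators on $K[X]$ are $T_if=-t^{-\frac12}f+(1+s_i)\Big(\frac{t^{-\frac12}-t^{\frac12}x_i^{-1}x_{i+1}}{1-x_i^{-1}x_{i+1}}f\Big)$, $1\le i\le n-1$; $T_w=T_{i_1}\cdots T_{i_\ell}$ for a reduced word $w=s_{i_1}\cdots s_{i_\ell}$; and $$\mathbf{1}_0=\sum_{w\in S_n}(t^{\frac12})^{\ell(w)-\ell(w_0)}T_w,\qquad\varepsilon_0=\sum_{w\in S_n}(-t^{-\frac12})^{\ell(w)-\ell(w_0)}T_w.$$ *)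

theory Defs
  imports
    "HOL-Library.Poly_Mapping"
    "HOL-Combinatorics.Permutations"
    "HOL-Computational_Algebra.Polynomial"
    "HOL-Computational_Algebra.Fraction_Field"
    Complex_Main
begin

section \<open>The field K and Laurent polynomials over it\<close>

text \<open>
  \<open>coeff_field\<close> is $K = \mathbb{C}(q,t^{1/2})$, realised as the fraction field of $\mathbb{C}[q][t^{1/2}]$:
  the inner polynomial variable is $q$, the outer one is $t^{1/2}$.
\<close>

type_synonym coeff_field = "complex poly poly fract"

definition q_par :: coeff_field
  where "q_par = Fraction_Field.Fract [:[:0, 1:]:] 1"

definition thalf :: coeff_field
  where "thalf = Fraction_Field.Fract [:0, 1:] 1"

definition t_par :: coeff_field
  where "t_par = thalf ^ 2"

text \<open>
  Laurent polynomials in variables $x_i$ indexed by all natural numbers, and their field of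
  fractions.  The ring $K[X] = K[x_1^{\pm1},\ldots,x_n^{\pm1}]$ is \<open>laurent_polys n\<close>, a subring of
  \<open>ratfun\<close>; formulas with denominators are computed in \<open>ratfun\<close>.
\<close>

type_synonym laurent = "(nat \<Rightarrow>\<^sub>0 int) \<Rightarrow>\<^sub>0 coeff_field"

type_synonym ratfun = "laurent fract"

definition of_laurent :: "laurent \<Rightarrow> ratfun"
  where "of_laurent f = Fraction_Field.Fract f 1"

definition const :: "coeff_field \<Rightarrow> ratfun"
  where "const c = of_laurent (Poly_Mapping.single 0 c)"

definition X :: "nat \<Rightarrow> ratfun"
  where "X i = of_laurent (Poly_Mapping.single (Poly_Mapping.single i 1) 1)"

definition laurent_polys :: "nat \<Rightarrow> ratfun set"
  where "laurent_polys n = of_laurent ` {f. \<forall>m \<in> Poly_Mapping.keys f. Poly_Mapping.keys m \<subseteq> {1..n}}"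

text \<open>
  Elements of $\mathbb{Z}^n$ are functions on \<open>nat\<close>, with the entries at the indices \<open>1, \<dots>, n\<close>
  and the value 0 at all other indices.
\<close>

definition weights :: "nat \<Rightarrow> (nat \<Rightarrow> int) set"
  where "weights n = {\<mu>. \<forall>i. i \<notin> {1..n} \<longrightarrow> \<mu> i = 0}"

text \<open>\<open>has_coeff n z \<mu> c\<close>: $z$ lies in $K[X]$ and the coefficient of $x^\mu$ in $z$ is $c$ (for \<open>\<mu> \<in> weights n\<close>).\<close>

definition has_coeff :: "nat \<Rightarrow> ratfun \<Rightarrow> (nat \<Rightarrow> int) \<Rightarrow> coeff_field \<Rightarrow> bool"
  where "has_coeff n z \<mu> c \<longleftrightarrow> z \<in> laurent_polys n \<and>
    (\<exists>f. z = of_laurent f \<and> Poly_Mapping.lookup f (Abs_poly_mapping \<mu>) = c)"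

text \<open>
  Substitution of $g(i)$ for $x_i$.  On fractions it is the quotient of the values, computed from
  any representation whose denominator does not evaluate to 0; the result does not depend on the
  representation (for $g$ with nonzero values).
\<close>

definition laurent_eval :: "(nat \<Rightarrow> ratfun) \<Rightarrow> laurent \<Rightarrow> ratfun"
  where "laurent_eval g f = (\<Sum>m \<in> Poly_Mapping.keys f.
    const (Poly_Mapping.lookup f m) * (\<Prod>i \<in> Poly_Mapping.keys m. g i powi Poly_Mapping.lookup m i))"

definition subst_vars :: "(nat \<Rightarrow> ratfun) \<Rightarrow> ratfun \<Rightarrow> ratfun"
  where "subst_vars g z = (THE y. \<exists>a b. laurent_eval g b \<noteq> 0 \<and>
    z = Fraction_Field.Fract a b \<and> y = laurent_eval g a / laurent_eval g b)"

section \<open>The symmetric group\<close>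

text \<open>$S_n$ is the set of all \<open>w\<close> with \<open>w permutes {1..n}\<close>.\<close>

definition simple_refl :: "nat \<Rightarrow> nat \<Rightarrow> nat"
  where "simple_refl i = transpose i (Suc i)"

definition word_perm :: "nat list \<Rightarrow> nat \<Rightarrow> nat"
  where "word_perm is = foldr (\<lambda>i w. simple_refl i \<circ> w) is id"

definition perm_length :: "nat \<Rightarrow> (nat \<Rightarrow> nat) \<Rightarrow> nat"
  where "perm_length n w = (LEAST k. \<exists>is. set is \<subseteq> {1..<n} \<and> word_perm is = w \<and> length is = k)"

definition reduced_word :: "nat \<Rightarrow> (nat \<Rightarrow> nat) \<Rightarrow> nat list \<Rightarrow> bool"
  where "reduced_word n w is \<longleftrightarrow>
    set is \<subseteq> {1..<n} \<and> word_perm is = w \<and> length is = perm_length n w"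

definition longest :: "nat \<Rightarrow> nat \<Rightarrow> nat"
  where "longest n = (ARG_MAX (perm_length n) w. w permutes {1..n})"

text \<open>$wx_i = x_{w(i)}$ and $(w\mu)_{w(i)} = \mu_i$, so that $wx^\mu = x^{w\mu}$.\<close>

definition perm_act :: "(nat \<Rightarrow> nat) \<Rightarrow> ratfun \<Rightarrow> ratfun"
  where "perm_act w = subst_vars (\<lambda>i. X (w i))"

definition weight_act :: "(nat \<Rightarrow> nat) \<Rightarrow> (nat \<Rightarrow> int) \<Rightarrow> nat \<Rightarrow> int"
  where "weight_act w \<mu> = \<mu> \<circ> inv w"

definition index_pairs :: "nat \<Rightarrow> (nat \<times> nat) set"
  where "index_pairs n = {(i, j). 1 \<le> i \<and> i < j \<and> j \<le> n}"

section \<open>Electronic Macdonald polynomials\<close>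

definition divided_diff :: "nat \<Rightarrow> ratfun \<Rightarrow> ratfun"
  where "divided_diff i f = (f - perm_act (simple_refl i) f) / (X i - X (Suc i))"

text \<open>The minimal length permutation sorting \<open>\<mu>\<close> into weakly increasing order, by its explicit formula.\<close>

definition sort_perm :: "nat \<Rightarrow> (nat \<Rightarrow> int) \<Rightarrow> nat \<Rightarrow> nat"
  where "sort_perm n \<mu> r =
    1 + card {r' \<in> {1..n}. r' < r \<and> \<mu> r' \<le> \<mu> r} + card {r' \<in> {1..n}. r < r' \<and> \<mu> r' < \<mu> r}"

text \<open>The weight $(\mu_n + 1, \mu_1, \ldots, \mu_{n-1})$.\<close>

definition rotate_weight :: "nat \<Rightarrow> (nat \<Rightarrow> int) \<Rightarrow> nat \<Rightarrow> int"
  where "rotate_weight n \<mu> i =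
    (if i = 1 then \<mu> n + 1 else if i \<in> {2..n} then \<mu> (i - 1) else 0)"

text \<open>The substitution $f \mapsto f(x_2, \ldots, x_n, q^{-1}x_1)$.\<close>

definition rotate_vars :: "nat \<Rightarrow> ratfun \<Rightarrow> ratfun"
  where "rotate_vars n = subst_vars
    (\<lambda>i. if i < n then X (Suc i) else if i = n then const (inverse q_par) * X 1 else X i)"

definition exchange_par :: "nat \<Rightarrow> (nat \<Rightarrow> int) \<Rightarrow> nat \<Rightarrow> coeff_field"
  where "exchange_par n \<mu> i = q_par powi (\<mu> i - \<mu> (Suc i)) *
    t_par powi (int (sort_perm n \<mu> i) - int (sort_perm n \<mu> (Suc i)))"

text \<open>
  \<open>E\<close> is the family $(E_\mu)_{\mu \in \mathbb{Z}^n}$ of electronic Macdonald polynomials; the last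
  four conditions are the recursion that determines the family.
\<close>

definition electronic_macdonald :: "nat \<Rightarrow> ((nat \<Rightarrow> int) \<Rightarrow> ratfun) \<Rightarrow> bool"
  where "electronic_macdonald n E \<longleftrightarrow>
    (\<forall>\<mu> \<in> weights n. E \<mu> \<in> laurent_polys n) \<and>
    E (\<lambda>_. 0) = 1 \<and>
    (\<forall>\<mu> \<in> weights n.
      E (rotate_weight n \<mu>) = const (q_par powi \<mu> n) * X 1 * rotate_vars n (E \<mu>)) \<and>
    (\<forall>\<mu> \<in> weights n. \<forall>i \<in> {1..<n}. (\<forall>j. 0 \<le> \<mu> j) \<and> \<mu> i > \<mu> (Suc i) \<longrightarrow>
      E (weight_act (simple_refl i) \<mu>) =
        divided_diff i (X i * E \<mu>) - const t_par * X i * divided_diff i (E \<mu>) +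
        const ((1 - t_par) * exchange_par n \<mu> i / (1 - exchange_par n \<mu> i)) * E \<mu>) \<and>
    (\<forall>\<mu> \<in> weights n.
      E (\<lambda>i. if i \<in> {1..n} then \<mu> i - 1 else 0) = (\<Prod>i\<in>{1..n}. inverse (X i)) * E \<mu>)"

section \<open>Bosonic and fermionic Macdonald polynomials\<close>

definition bosonic_sum :: "nat \<Rightarrow> ((nat \<Rightarrow> int) \<Rightarrow> ratfun) \<Rightarrow> (nat \<Rightarrow> int) \<Rightarrow> ratfun"
  where "bosonic_sum n E \<nu> = (\<Sum>w | w permutes {1..n}.
    perm_act w (E \<nu> * (\<Prod>(i, j) \<in> index_pairs n. (X i - const t_par * X j) / (X i - X j))))"

text \<open>The normalizing constant $W_\nu(t)$; since \<open>1 / 0 = 0\<close>, it is necessarily nonzero.\<close>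

definition normalizing_const :: "nat \<Rightarrow> ((nat \<Rightarrow> int) \<Rightarrow> ratfun) \<Rightarrow> (nat \<Rightarrow> int) \<Rightarrow> coeff_field"
  where "normalizing_const n E \<nu> = (THE c. has_coeff n (const (1 / c) * bosonic_sum n E \<nu>) \<nu> 1)"

definition bosonic_macdonald :: "nat \<Rightarrow> ((nat \<Rightarrow> int) \<Rightarrow> ratfun) \<Rightarrow> (nat \<Rightarrow> int) \<Rightarrow> ratfun"
  where "bosonic_macdonald n E \<nu> = const (1 / normalizing_const n E \<nu>) * bosonic_sum n E \<nu>"

text \<open>\<open>fermionic_macdonald n E \<nu>\<close> is $A_\nu$.\<close>

definition fermionic_macdonald :: "nat \<Rightarrow> ((nat \<Rightarrow> int) \<Rightarrow> ratfun) \<Rightarrow> (nat \<Rightarrow> int) \<Rightarrow> ratfun"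
  where "fermionic_macdonald n E \<nu> =
    (\<Prod>(i, j) \<in> index_pairs n. (X j - const t_par * X i) / (X i - X j)) *
    (\<Sum>w | w permutes {1..n}. (- 1) ^ perm_length n w * perm_act w (E \<nu>))"

definition rho :: "nat \<Rightarrow> nat \<Rightarrow> int"
  where "rho n i = (if i \<in> {1..n} then int n - int i else 0)"

section \<open>Hecke operators and symmetrizers\<close>

definition hecke :: "nat \<Rightarrow> ratfun \<Rightarrow> ratfun"
  where "hecke i f = - const (inverse thalf) * f +
    (let g = (const (inverse thalf) - const thalf * inverse (X i) * X (Suc i)) /
             (1 - inverse (X i) * X (Suc i)) * f
     in g + perm_act (simple_refl i) g)"

definition hecke_perm :: "nat \<Rightarrow> (nat \<Rightarrow> nat) \<Rightarrow> ratfun \<Rightarrow> ratfun"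
  where "hecke_perm n w = foldr hecke (SOME is. reduced_word n w is)"

definition bosonic_symmetrizer :: "nat \<Rightarrow> ratfun \<Rightarrow> ratfun"
  where "bosonic_symmetrizer n f = (\<Sum>w | w permutes {1..n}.
    const (thalf powi (int (perm_length n w) - int (perm_length n (longest n)))) * hecke_perm n w f)"

definition fermionic_symmetrizer :: "nat \<Rightarrow> ratfun \<Rightarrow> ratfun"
  where "fermionic_symmetrizer n f = (\<Sum>w | w permutes {1..n}.
    const ((- inverse thalf) powi (int (perm_length n w) - int (perm_length n (longest n)))) *
    hecke_perm n w f)"

end

theory Submission
  imports Defs
begin

text \<open>
  Write $t^{1/2}T_i = A_i + B_i s_i$ in the twisted group algebra of $S_n$ over rational functions.
  For $\beta = 1$ and $\beta = -t^{-1}$ the element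
  $S = \sum_w \beta^{\ell(w)} t^{\ell(w)/2} T_w$ satisfies $t^{1/2}T_i S = \beta t S$, which says
  how the coefficients of $v$ and $s_i v$ in $S$ are related; hence all of them are determined by the
  coefficient of $w_0$. Only $T_{w_0}$ contributes to the latter, and it contributes
  $\prod_{i<j} (t x_i - x_j)/(x_i - x_j)$. This gives both operator identities.

  That $x^\lambda$ has a nonzero coefficient in the symmetrization of $E_\lambda$ follows by
  specialising $t^{1/2} = 1$: no denominator in the recursion for $E_\mu$ vanishes there, and
  $E_\mu$ becomes $x^\mu$, $t^{1/2}T_i$ becomes $s_i$, so the coefficient becomes the order of the
  stabilizer of $\lambda$.
\<close>

section \<open>Substitutions in Laurent polynomials and rational functions\<close>

text \<open>Comparing coefficients of two operators on rational functions would presuppose linear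
  independence of field automorphisms. The computation therefore runs on the coefficient functions
  themselves, and operators return only at the end. The braid and quadratic relations are proved at
  that level; the braid relations are needed because T_w is defined through an arbitrarily chosen
  reduced word. The numbers \<beta> t are the eigenvalues t and -1 of T = t^(1/2) T_i, whose
  quadratic relation is (T - t)(T + 1) = 0. The normalizing constant is a definite description with
  1/0 = 0, so it has its meaning only once a coefficient is known to be nonzero. Setting t^(1/2) = 1
  is not a map on K, since elements may have a pole there; it is replaced by congruence modulo
  t^(1/2) - 1 over the local ring of elements without such a pole.\<close>

locale ratfun_hom =
  fixes \<phi> :: "ratfun \<Rightarrow> ratfun"
  assumes add: "\<phi> (x + y) = \<phi> x + \<phi> y"
    and mult: "\<phi> (x * y) = \<phi> x * \<phi> y"
    and const: "\<phi> (const c) = const c"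
begin

lemma zero [simp]: "\<phi> 0 = 0"
  by (metis add add_0 add_cancel_right_left)

lemma one [simp]: "\<phi> 1 = 1"
  using const[of 1] by (simp add: const_def of_laurent_def fract_collapse)

lemma uminus: "\<phi> (- x) = - \<phi> x"
  using add[of x "- x"] by (simp add: eq_neg_iff_add_eq_0 add.commute)

lemma diff: "\<phi> (x - y) = \<phi> x - \<phi> y"
  using add[of x "- y"] by (simp add: uminus)

lemma inverse: "\<phi> (inverse x) = inverse (\<phi> x)"
proof (cases "x = 0")
  case False
  then have "\<phi> x * \<phi> (inverse x) = 1" by (simp flip: mult)
  then show ?thesis by (metis inverse_unique)
qed simp

lemma divide: "\<phi> (x / y) = \<phi> x / \<phi> y"
  by (simp add: divide_inverse mult inverse)

lemma power: "\<phi> (x ^ k) = \<phi> x ^ k"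
  by (induction k) (simp_all add: mult)

lemma power_int: "\<phi> (x powi k) = \<phi> x powi k"
  by (simp add: power_int_def power inverse)

lemma sum: "\<phi> (\<Sum>a\<in>A. f a) = (\<Sum>a\<in>A. \<phi> (f a))"
  by (induction A rule: infinite_finite_induct) (simp_all add: add)

lemma prod: "\<phi> (\<Prod>a\<in>A. f a) = (\<Prod>a\<in>A. \<phi> (f a))"
  by (induction A rule: infinite_finite_induct) (simp_all add: mult)

lemma eq_0_iff [simp]: "\<phi> x = 0 \<longleftrightarrow> x = 0"
  by (metis inverse mult one right_inverse mult_zero_left zero zero_neq_one)

lemmas homs = add mult const uminus diff inverse divide power power_int sum prod

end

section \<open>Constants, variables and monomials in the fraction field\<close>

lemma of_laurent_0 [simp]: "of_laurent 0 = 0"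
  and of_laurent_1 [simp]: "of_laurent 1 = 1"
  and of_laurent_add: "of_laurent (f + g) = of_laurent f + of_laurent g"
  and of_laurent_mult: "of_laurent (f * g) = of_laurent f * of_laurent g"
  and of_laurent_inject: "of_laurent f = of_laurent g \<longleftrightarrow> f = g"
  by (simp_all add: of_laurent_def fract_collapse eq_fract)

lemma of_laurent_sum: "of_laurent (\<Sum>a\<in>A. f a) = (\<Sum>a\<in>A. of_laurent (f a))"
  by (induction A rule: infinite_finite_induct) (simp_all add: of_laurent_add)

lemma Fract_eq_divide: "Fraction_Field.Fract a b = of_laurent a / of_laurent b"
  by (simp add: of_laurent_def)

lemma const_0 [simp]: "const 0 = 0"
  and const_1 [simp]: "const 1 = 1"
  and const_add: "const (a + b) = const a + const b"
  by (simp_all add: const_def single_add of_laurent_add)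

lemma const_mult: "const (a * b) = const a * const b"
  unfolding const_def of_laurent_mult[symmetric] mult_single by simp

lemma const_uminus: "const (- a) = - const a"
  using const_add[of a "- a"] by (simp add: eq_neg_iff_add_eq_0 add.commute)

lemma const_diff: "const (a - b) = const a - const b"
  using const_add[of a "- b"] by (simp add: const_uminus)

lemma const_inverse: "const (inverse a) = inverse (const a)"
proof (cases "a = 0")
  case False
  then have "const a * const (inverse a) = 1" by (simp flip: const_mult)
  then show ?thesis by (metis inverse_unique)
qed simp

lemma const_power: "const (a ^ k) = const a ^ k"
  by (induction k) (simp_all add: const_mult)

lemma const_power_int: "const (a powi k) = const a powi k"
  by (simp add: power_int_def const_power const_inverse)

lemma const_inject [simp]: "const a = const b \<longleftrightarrow> a = b"
  by (simp add: const_def of_laurent_inject inj_eq)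

lemma const_eq_0_iff [simp]: "const a = 0 \<longleftrightarrow> a = 0"
  using const_inject[of a 0] by (simp del: const_inject)

lemma X_inject [simp]: "X i = X j \<longleftrightarrow> i = j"
proof
  assume "X i = X j"
  then have "Poly_Mapping.single (Poly_Mapping.single i (1::int)) (1::coeff_field)
    = Poly_Mapping.single (Poly_Mapping.single j 1) 1"
    by (simp add: X_def of_laurent_inject)
  then have "Poly_Mapping.keys (Poly_Mapping.single i (1::int)) = Poly_Mapping.keys (Poly_Mapping.single j (1::int))"
    by (metis keys_single singleton_inject zero_neq_one)
  then show "i = j" by simp
qed auto

lemma X_nonzero [simp]: "X i \<noteq> 0"
proof -
  have "of_laurent (Poly_Mapping.single (Poly_Mapping.single i 1) 1) \<noteq> of_laurent 0"
    unfolding of_laurent_inject by (metis keys_single keys_zero insert_not_empty zero_neq_one)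
  then show ?thesis by (simp add: X_def)
qed

lemma of_laurent_single_add:
  "of_laurent (Poly_Mapping.single (m + m') (a * b)) =
   of_laurent (Poly_Mapping.single m a) * of_laurent (Poly_Mapping.single m' b)"
  by (simp add: mult_single flip: of_laurent_mult)

lemma X_powi: "X i powi k = of_laurent (Poly_Mapping.single (Poly_Mapping.single i k) 1)"
proof -
  have nat: "X i ^ k = of_laurent (Poly_Mapping.single (Poly_Mapping.single i (int k)) 1)" for k
  proof (induction k)
    case (Suc k)
    have "X i ^ Suc k = of_laurent (Poly_Mapping.single (Poly_Mapping.single i 1 + Poly_Mapping.single i (int k)) (1 * 1))"
      using Suc unfolding of_laurent_single_add by (simp add: X_def)
    then show ?case by (simp flip: single_add)
  qed simp
  have "of_laurent (Poly_Mapping.single (Poly_Mapping.single i (- int k)) 1) = inverse (X i ^ k)" for k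
  proof -
    have "of_laurent (Poly_Mapping.single (Poly_Mapping.single i (int k) + Poly_Mapping.single i (- int k)) (1 * 1)) = 1"
      by (simp flip: single_add)
    then show ?thesis
      unfolding of_laurent_single_add nat[symmetric] by (metis inverse_unique)
  qed
  then show ?thesis
    by (cases k rule: int_cases2) (simp_all add: nat power_int_minus)
qed

section \<open>Evaluation of Laurent polynomials at points of the fraction field\<close>

definition monomial_eval :: "(nat \<Rightarrow> ratfun) \<Rightarrow> (nat \<Rightarrow>\<^sub>0 int) \<Rightarrow> ratfun"
  where "monomial_eval g m = (\<Prod>i \<in> Poly_Mapping.keys m. g i powi Poly_Mapping.lookup m i)"

lemma monomial_eval_superset:
  assumes "finite A" "Poly_Mapping.keys m \<subseteq> A"
  shows "monomial_eval g m = (\<Prod>i\<in>A. g i powi Poly_Mapping.lookup m i)"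
  unfolding monomial_eval_def
  by (rule prod.mono_neutral_left) (use assms in \<open>auto simp: in_keys_iff\<close>)

text \<open>Exponents may cancel: at the value 0, exponents 1 and -1 give the product 0, whereas
  their sum gives 0 to the power 0, which is 1. Hence the values must be nonzero.\<close>

lemma monomial_eval_add:
  assumes "\<And>i. g i \<noteq> 0"
  shows "monomial_eval g (m + m') = monomial_eval g m * monomial_eval g m'"
proof -
  let ?A = "Poly_Mapping.keys m \<union> Poly_Mapping.keys m'"
  have "monomial_eval g (m + m') = (\<Prod>i\<in>?A. g i powi Poly_Mapping.lookup (m + m') i)"
    by (rule monomial_eval_superset) (simp_all add: Poly_Mapping.keys_add)
  also have "\<dots> = monomial_eval g m * monomial_eval g m'"
    by (simp add: monomial_eval_superset[of ?A] lookup_add power_int_add assms prod.distrib)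
  finally show ?thesis .
qed

lemma laurent_eval_superset:
  assumes "finite A" "Poly_Mapping.keys f \<subseteq> A"
  shows "laurent_eval g f = (\<Sum>m\<in>A. const (Poly_Mapping.lookup f m) * monomial_eval g m)"
  unfolding laurent_eval_def monomial_eval_def
  by (rule sum.mono_neutral_left) (use assms in \<open>auto simp: in_keys_iff\<close>)

lemma laurent_eval_single: "laurent_eval g (Poly_Mapping.single m a) = const a * monomial_eval g m"
  by (subst laurent_eval_superset[of "{m}"]) auto

lemma laurent_eval_add: "laurent_eval g (f + h) = laurent_eval g f + laurent_eval g h"
proof -
  let ?A = "Poly_Mapping.keys f \<union> Poly_Mapping.keys h"
  have "laurent_eval g (f + h) = (\<Sum>m\<in>?A. const (Poly_Mapping.lookup (f + h) m) * monomial_eval g m)"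
    by (rule laurent_eval_superset) (simp_all add: Poly_Mapping.keys_add)
  also have "\<dots> = laurent_eval g f + laurent_eval g h"
    by (simp add: laurent_eval_superset[of ?A] lookup_add const_add distrib_right sum.distrib)
  finally show ?thesis .
qed

lemma laurent_eval_0 [simp]: "laurent_eval g 0 = 0"
  by (simp add: laurent_eval_def)

lemma laurent_eval_sum: "laurent_eval g (\<Sum>a\<in>A. f a) = (\<Sum>a\<in>A. laurent_eval g (f a))"
  by (induction A rule: infinite_finite_induct) (simp_all add: laurent_eval_add)

lemma poly_mapping_sum_singles:
  fixes f :: "'a \<Rightarrow>\<^sub>0 'b::comm_monoid_add"
  shows "f = (\<Sum>m\<in>Poly_Mapping.keys f. Poly_Mapping.single m (Poly_Mapping.lookup f m))"
  by (rule poly_mapping_eqI) (auto simp: lookup_sum lookup_single when_def in_keys_iff)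

text \<open>Both factors are expanded into single terms, where multiplicativity is that of
  monomials, and then reassembled.\<close>

lemma laurent_eval_mult:
  assumes "\<And>i. g i \<noteq> 0"
  shows "laurent_eval g (f * h) = laurent_eval g f * laurent_eval g h"
proof -
  let ?s = "\<lambda>f m. Poly_Mapping.single m (Poly_Mapping.lookup f m)"
  have "f * h = (\<Sum>m\<in>Poly_Mapping.keys f. \<Sum>m'\<in>Poly_Mapping.keys h. ?s f m * ?s h m')"
    by (simp only: sum_product[symmetric] poly_mapping_sum_singles[symmetric])
  then have "laurent_eval g (f * h) =
      (\<Sum>m\<in>Poly_Mapping.keys f. \<Sum>m'\<in>Poly_Mapping.keys h. laurent_eval g (?s f m) * laurent_eval g (?s h m'))"
    by (simp add: laurent_eval_sum mult_single laurent_eval_single monomial_eval_add assms const_mult mult.assoc mult.left_commute)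
  also have "\<dots> = laurent_eval g f * laurent_eval g h"
    by (simp only: sum_product[symmetric] laurent_eval_sum[symmetric] poly_mapping_sum_singles[symmetric])
  finally show ?thesis .
qed

lemma monomial_eval_X: "monomial_eval X m = of_laurent (Poly_Mapping.single m 1)"
proof -
  have *: "(\<Prod>i\<in>A. X i powi Poly_Mapping.lookup m i) =
      of_laurent (Poly_Mapping.single (\<Sum>i\<in>A. Poly_Mapping.single i (Poly_Mapping.lookup m i)) 1)" if "finite A" for A
    using that
    by (induction) (simp_all add: X_powi of_laurent_single_add[where a = 1 and b = 1, simplified])
  show ?thesis
    unfolding monomial_eval_def by (subst *) (simp_all add: poly_mapping_sum_singles[symmetric])
qed

lemma of_laurent_single: "of_laurent (Poly_Mapping.single m a) = const a * monomial_eval X m"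
  using of_laurent_single_add[of 0 m a 1] by (simp add: const_def monomial_eval_X)

lemma laurent_eval_X: "laurent_eval X f = of_laurent f"
  by (subst (2) poly_mapping_sum_singles)
    (simp add: of_laurent_sum of_laurent_single laurent_eval_def monomial_eval_def)

lemma (in ratfun_hom) laurent_eval: "\<phi> (laurent_eval g f) = laurent_eval (\<lambda>i. \<phi> (g i)) f"
  by (simp add: laurent_eval_def homs)

text \<open>Every rational function is a quotient of two values of \<open>laurent_eval X\<close>,
  and homomorphisms commute with evaluation, so only the images of the variables matter.\<close>

lemma ratfun_hom_eqI:
  assumes "ratfun_hom \<phi>" "ratfun_hom \<psi>" "\<And>i. \<phi> (X i) = \<psi> (X i)"
  shows "\<phi> = \<psi>"
proof
  fix z :: ratfun
  interpret \<phi>: ratfun_hom \<phi> by fact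
  interpret \<psi>: ratfun_hom \<psi> by fact
  obtain a b where z: "z = Fraction_Field.Fract a b" by (cases z)
  show "\<phi> z = \<psi> z"
    unfolding z Fract_eq_divide
    by (simp add: \<phi>.homs \<psi>.homs \<phi>.laurent_eval \<psi>.laurent_eval assms(3) flip: laurent_eval_X)
qed

text \<open>The definite description in \<open>subst_vars\<close> is well posed: two representations
  of one fraction are related by cross-multiplication, and evaluation preserves that relation
  because it is multiplicative.\<close>

lemma subst_vars_Fract:
  assumes g: "\<And>i. g i \<noteq> 0" and b: "laurent_eval g b \<noteq> 0"
  shows "subst_vars g (Fraction_Field.Fract a b) = laurent_eval g a / laurent_eval g b"
  unfolding subst_vars_def
proof (rule the_equality)
  show "\<exists>a' b'. laurent_eval g b' \<noteq> 0 \<and> Fraction_Field.Fract a b = Fraction_Field.Fract a' b' \<and>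
      laurent_eval g a / laurent_eval g b = laurent_eval g a' / laurent_eval g b'"
    using b by blast
next
  fix y assume "\<exists>a' b'. laurent_eval g b' \<noteq> 0 \<and> Fraction_Field.Fract a b = Fraction_Field.Fract a' b' \<and>
      y = laurent_eval g a' / laurent_eval g b'"
  then obtain a' b' where *: "laurent_eval g b' \<noteq> 0" "Fraction_Field.Fract a b = Fraction_Field.Fract a' b'"
    "y = laurent_eval g a' / laurent_eval g b'" by blast
  \<comment> \<open>Fractions with denominator 0 collapse to 0, so this must be excluded before
    cross-multiplying.\<close>
  have "b \<noteq> 0" "b' \<noteq> 0" using b *(1) by auto
  with * have "a * b' = a' * b" by (simp add: eq_fract)
  then have "laurent_eval g a * laurent_eval g b' = laurent_eval g a' * laurent_eval g b"
    by (simp flip: laurent_eval_mult[OF g])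
  then show "y = laurent_eval g a / laurent_eval g b"
    using * b by (simp add: frac_eq_eq)
qed

lemma laurent_eval_const: "laurent_eval g (Poly_Mapping.single 0 c) = const c"
  by (simp add: laurent_eval_single monomial_eval_def)

lemma laurent_eval_1 [simp]: "laurent_eval g 1 = 1"
  using laurent_eval_const[of g 1] by simp

lemma subst_vars_of_laurent:
  assumes "\<And>i. g i \<noteq> 0"
  shows "subst_vars g (of_laurent f) = laurent_eval g f"
  unfolding of_laurent_def by (simp add: subst_vars_Fract assms)

text \<open>With trivial kernel, every nonzero denominator is an admissible one, including the
  products that arise when fractions are added or multiplied.\<close>

lemma subst_vars_hom:
  assumes g: "\<And>i. g i \<noteq> 0" and inj: "\<And>b. b \<noteq> 0 \<Longrightarrow> laurent_eval g b \<noteq> 0"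
  shows "ratfun_hom (subst_vars g)"
proof
  fix x y :: ratfun and c
  obtain a b where x: "x = Fraction_Field.Fract a b" "b \<noteq> 0" by (cases x)
  obtain a' b' where y: "y = Fraction_Field.Fract a' b'" "b' \<noteq> 0" by (cases y)
  show "subst_vars g (x + y) = subst_vars g x + subst_vars g y"
    using x y inj by (simp add: subst_vars_Fract laurent_eval_add laurent_eval_mult g add_frac_eq)
  show "subst_vars g (x * y) = subst_vars g x * subst_vars g y"
    using x y inj by (simp add: subst_vars_Fract laurent_eval_mult g)
  show "subst_vars g (const c) = const c"
    by (simp add: const_def[of c] subst_vars_of_laurent g laurent_eval_const)
qed

text \<open>Permuting the variables sends distinct monomials to distinct monomials, so it has trivial kernel.\<close>

lemma laurent_eval_perm_inj:
  assumes w: "bij w" and b: "b \<noteq> 0"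
  shows "laurent_eval (\<lambda>i. X (w i)) b \<noteq> 0"
proof -
  \<comment> \<open>\<open>map_key\<close> precomposes with its argument, so the inverse of w is
    what moves the exponent at i to position w i.\<close>
  define p where "p m = Poly_Mapping.map_key (inv w) m" for m :: "nat \<Rightarrow>\<^sub>0 int"
  have inj: "inj (inv w)" using w bij_imp_bij_inv bij_is_inj by blast
  have lookup_p: "Poly_Mapping.lookup (p m) i = Poly_Mapping.lookup m (inv w i)" for m i
    unfolding p_def by (simp add: map_key.rep_eq inj)
  have p_inj: "p m = p m' \<longleftrightarrow> m = m'" for m m'
  proof
    assume eq: "p m = p m'"
    show "m = m'"
    proof (rule poly_mapping_eqI)
      fix i
      show "Poly_Mapping.lookup m i = Poly_Mapping.lookup m' i"
        using lookup_p[of m "w i"] lookup_p[of m' "w i"] eq w by (simp add: bij_is_inj)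
    qed
  qed simp
  have keys_p: "Poly_Mapping.keys (p m) = w ` Poly_Mapping.keys m" for m
  proof (intro set_eqI)
    fix i
    have "i \<in> w ` Poly_Mapping.keys m \<longleftrightarrow> inv w i \<in> Poly_Mapping.keys m"
      using w by (auto simp: bij_is_inj bij_is_surj surj_f_inv_f intro!: image_eqI[of i w "inv w i"])
    then show "i \<in> Poly_Mapping.keys (p m) \<longleftrightarrow> i \<in> w ` Poly_Mapping.keys m"
      by (simp add: in_keys_iff lookup_p)
  qed
  have mon: "monomial_eval (\<lambda>i. X (w i)) m = monomial_eval X (p m)" for m
    unfolding monomial_eval_def keys_p
    using prod.reindex[OF bij_is_inj[OF w, THEN inj_on_subset, OF subset_UNIV],
        of "\<lambda>i. X i powi Poly_Mapping.lookup m (inv w i)" "Poly_Mapping.keys m"] w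
    by (simp add: lookup_p bij_is_inj o_def)
  define f where "f = (\<Sum>m\<in>Poly_Mapping.keys b. Poly_Mapping.single (p m) (Poly_Mapping.lookup b m))"
  have "laurent_eval (\<lambda>i. X (w i)) b = of_laurent f"
    unfolding f_def laurent_eval_def monomial_eval_def[symmetric] of_laurent_sum mon
    by (simp add: of_laurent_single)
  moreover have "f \<noteq> 0"
  proof -
    obtain k where k: "k \<in> Poly_Mapping.keys b" using b by (metis keys_eq_empty ex_in_conv)
    have "Poly_Mapping.lookup f (p k) = Poly_Mapping.lookup b k"
      using k by (simp add: f_def lookup_sum lookup_single when_def p_inj)
    then show ?thesis using k by (auto simp: in_keys_iff)
  qed
  ultimately show ?thesis by (metis of_laurent_0 of_laurent_inject)
qed

lemma perm_act_hom: "bij w \<Longrightarrow> ratfun_hom (perm_act w)"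
  unfolding perm_act_def by (intro subst_vars_hom laurent_eval_perm_inj) simp_all

lemma perm_act_X: "perm_act w (X i) = X (w i)"
  unfolding perm_act_def X_def[of i]
  by (simp add: subst_vars_of_laurent laurent_eval_single monomial_eval_def)

lemma perm_act_comp:
  assumes "bij u" "bij v"
  shows "perm_act (u \<circ> v) z = perm_act u (perm_act v z)"
proof -
  interpret u: ratfun_hom "perm_act u" by (rule perm_act_hom) fact
  interpret v: ratfun_hom "perm_act v" by (rule perm_act_hom) fact
  have "perm_act (u \<circ> v) = (\<lambda>z. perm_act u (perm_act v z))"
  proof (rule ratfun_hom_eqI)
    show "ratfun_hom (perm_act (u \<circ> v))" using assms by (simp add: perm_act_hom bij_comp)
    show "ratfun_hom (\<lambda>z. perm_act u (perm_act v z))" by unfold_locales (simp_all add: u.homs v.homs)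
    show "perm_act (u \<circ> v) (X i) = perm_act u (perm_act v (X i))" for i
      using assms by (simp add: perm_act_X bij_comp)
  qed
  then show ?thesis by simp
qed

lemma perm_act_id [simp]: "perm_act id z = z"
proof -
  have "perm_act id = (\<lambda>z. z)"
  proof (rule ratfun_hom_eqI)
    show "ratfun_hom (perm_act id)" by (simp add: perm_act_hom)
    show "ratfun_hom (\<lambda>z. z)" by unfold_locales simp_all
  qed (simp add: perm_act_X)
  then show ?thesis by simp
qed

section \<open>Length and reduced words\<close>

declare One_nat_def [simp del]

lemma simple_refl_apply: "simple_refl i k = (if k = i then Suc i else if k = Suc i then i else k)"
  by (simp add: simple_refl_def transpose_def)

lemma simple_refl_simple_refl [simp]: "simple_refl i (simple_refl i k) = k"
  by (simp add: simple_refl_apply)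

lemma simple_refl_comp [simp]: "simple_refl i \<circ> simple_refl i = id"
  "simple_refl i \<circ> (simple_refl i \<circ> w) = w"
  by (auto simp: fun_eq_iff)

lemma bij_simple_refl [simp]: "bij (simple_refl i)"
  by (rule o_bij[of "simple_refl i"]) simp_all

lemma inv_simple_refl [simp]: "inv (simple_refl i) = simple_refl i"
  by (rule inv_equality) simp_all

lemma simple_refl_permutes: "i \<in> {1..<n} \<Longrightarrow> simple_refl i permutes {1..n}"
  unfolding simple_refl_def by (rule permutes_swap_id) auto

lemma simple_refl_comp_permutes:
  "i \<in> {1..<n} \<Longrightarrow> w permutes {1..n} \<Longrightarrow> simple_refl i \<circ> w permutes {1..n}"
  by (simp add: permutes_compose simple_refl_permutes)

lemma inv_simple_refl_comp: "bij w \<Longrightarrow> inv (simple_refl i \<circ> w) = inv w \<circ> simple_refl i"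
  by (simp add: o_inv_distrib)

text \<open>The trailing \<open>w\<close> lets the relation rewrite right-nested composites
  directly.\<close>

lemma simple_refl_braid:
  "simple_refl i \<circ> (simple_refl (Suc i) \<circ> (simple_refl i \<circ> w)) =
   simple_refl (Suc i) \<circ> (simple_refl i \<circ> (simple_refl (Suc i) \<circ> w))"
  by (auto simp: fun_eq_iff simple_refl_apply)

lemma simple_refl_commute:
  "Suc i < j \<Longrightarrow> simple_refl i \<circ> (simple_refl j \<circ> w) = simple_refl j \<circ> (simple_refl i \<circ> w)"
  by (auto simp: fun_eq_iff simple_refl_apply)

lemma word_perm_simps [simp]:
  "word_perm [] = id"
  "word_perm (i # is) = simple_refl i \<circ> word_perm is"
  by (simp_all add: word_perm_def)

lemma word_perm_permutes: "set is \<subseteq> {1..<n} \<Longrightarrow> word_perm is permutes {1..n}"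
  by (induction "is") (simp_all add: permutes_id simple_refl_comp_permutes del: o_apply)

text \<open>Inversions are recorded by values instead of positions, so that left multiplication by a
  simple reflection acts on them directly.\<close>

definition inversions :: "nat \<Rightarrow> (nat \<Rightarrow> nat) \<Rightarrow> (nat \<times> nat) set"
  where "inversions n w = {(i, j) \<in> index_pairs n. inv w j < inv w i}"

lemma finite_index_pairs [simp]: "finite (index_pairs n)"
  by (rule finite_subset[of _ "{1..n} \<times> {1..n}"]) (auto simp: index_pairs_def)

lemma inversions_subset: "inversions n w \<subseteq> index_pairs n"
  by (auto simp: inversions_def)

lemma finite_inversions [simp]: "finite (inversions n w)"
  using inversions_subset finite_index_pairs by (rule finite_subset)

text \<open>In terms of roots: a simple reflection permutes the positive roots other than its own
  simple root.\<close>

lemma simple_refl_index_pairs: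
  assumes "i \<in> {1..<n}"
  shows "map_prod (simple_refl i) (simple_refl i) p \<in> index_pairs n - {(i, Suc i)} \<longleftrightarrow>
    p \<in> index_pairs n - {(i, Suc i)}"
  using assms by (cases p) (auto simp: index_pairs_def simple_refl_apply)

text \<open>The hypothesis says that the value i occurs before the value i + 1. Exchanging these two
  adjacent values makes them an inversion and only relabels all the others.\<close>

lemma inversions_simple_refl_comp:
  assumes i: "i \<in> {1..<n}" and w: "w permutes {1..n}" and asc: "inv w i < inv w (Suc i)"
  shows "inversions n (simple_refl i \<circ> w) =
      insert (i, Suc i) (map_prod (simple_refl i) (simple_refl i) ` inversions n w)" (is "?L = ?R")
    and "(i, Suc i) \<notin> map_prod (simple_refl i) (simple_refl i) ` inversions n w"
proof -
  let ?s = "map_prod (simple_refl i) (simple_refl i)"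
  have inv: "inv (simple_refl i \<circ> w) = inv w \<circ> simple_refl i"
    using w by (simp add: inv_simple_refl_comp permutes_bij)
  have mem: "p \<in> ?s ` A \<longleftrightarrow> ?s p \<in> A" for p A
    by (cases p) force
  have not_inv: "(i, Suc i) \<notin> inversions n w" using asc by (auto simp: inversions_def)
  have pair: "?s (i, Suc i) = (Suc i, i)" by (simp add: simple_refl_apply)
  show not_im: "(i, Suc i) \<notin> ?s ` inversions n w"
    unfolding mem pair by (simp add: inversions_def index_pairs_def)
  show "?L = ?R"
  proof (rule set_eqI)
    fix p :: "nat \<times> nat"
    show "p \<in> ?L \<longleftrightarrow> p \<in> ?R"
    proof (cases "p = (i, Suc i)")
      case True
      then show ?thesis
        using i asc by (simp add: inversions_def inv index_pairs_def simple_refl_apply)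
    next
      case False
      have "?s p \<in> index_pairs n - {(i, Suc i)} \<longleftrightarrow> p \<in> index_pairs n - {(i, Suc i)}"
        by (rule simple_refl_index_pairs[OF i])
      \<comment> \<open>The only preimage of (i, i + 1) is (i + 1, i), which is not
        increasing.\<close>
      moreover have "?s p \<noteq> (i, Suc i) \<or> p \<notin> index_pairs n"
        by (cases p) (auto simp: index_pairs_def simple_refl_apply split: if_splits)
      ultimately have "?s p \<in> inversions n w \<longleftrightarrow> p \<in> ?L"
        using False not_inv by (cases p) (auto simp: inversions_def inv)
      then show ?thesis using False by (simp add: mem)
    qed
  qed
qed

lemma card_inversions_ascent:
  assumes "i \<in> {1..<n}" "w permutes {1..n}" "inv w i < inv w (Suc i)"
  shows "card (inversions n (simple_refl i \<circ> w)) = Suc (card (inversions n w))"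
proof -
  have "inj (map_prod (simple_refl i) (simple_refl i))"
    by (intro prod.inj_map bij_is_inj bij_simple_refl)
  then show ?thesis
    using inversions_simple_refl_comp[OF assms] by (simp add: card_image inj_on_subset)
qed

lemma inv_permutes_neq: "w permutes {1..n} \<Longrightarrow> inv w i \<noteq> inv w (Suc i)"
  by (metis bij_inv_eq_iff n_not_Suc_n permutes_bij)

lemma card_inversions_descent:
  assumes i: "i \<in> {1..<n}" and w: "w permutes {1..n}" and desc: "inv w (Suc i) < inv w i"
  shows "card (inversions n w) = Suc (card (inversions n (simple_refl i \<circ> w)))"
proof -
  have "inv (simple_refl i \<circ> w) i < inv (simple_refl i \<circ> w) (Suc i)"
    using desc w by (simp add: inv_simple_refl_comp permutes_bij simple_refl_apply)
  then show ?thesis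
    using card_inversions_ascent[OF i simple_refl_comp_permutes[OF i w]] by simp
qed

lemma card_inversions_simple_refl_le:
  assumes "i \<in> {1..<n}" "w permutes {1..n}"
  shows "card (inversions n w) \<le> Suc (card (inversions n (simple_refl i \<circ> w)))"
    and "card (inversions n (simple_refl i \<circ> w)) \<le> Suc (card (inversions n w))"
  using card_inversions_ascent[OF assms] card_inversions_descent[OF assms] inv_permutes_neq[OF assms(2), of i]
  by linarith+

lemma card_inversions_word_perm:
  "set is \<subseteq> {1..<n} \<Longrightarrow> card (inversions n (word_perm is)) \<le> length is"
proof (induction "is")
  case Nil
  have "inversions n id = {}" by (auto simp: inversions_def index_pairs_def)
  then show ?case by (simp only: word_perm_simps card.empty list.size order.refl)
next
  case (Cons i "is")
  then have "card (inversions n (simple_refl i \<circ> word_perm is)) \<le> Suc (card (inversions n (word_perm is)))"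
    by (intro card_inversions_simple_refl_le word_perm_permutes) auto
  with Cons have "card (inversions n (simple_refl i \<circ> word_perm is)) \<le> Suc (length is)" by auto
  then show ?case by (simp only: word_perm_simps length_Cons)
qed

text \<open>Climbing from 1 gives i \<le> v i; descending from n gives v i \<le> i.\<close>

lemma permutes_increasing_imp_id:
  assumes v: "v permutes {1..n}" and inc: "\<And>i. i \<in> {1..<n} \<Longrightarrow> v i < v (Suc i)"
  shows "v = id"
proof -
  have mem: "i \<in> {1..n} \<Longrightarrow> v i \<in> {1..n}" for i
    using v by (simp only: permutes_in_image)
  have lower: "1 \<le> i \<Longrightarrow> i \<le> n \<Longrightarrow> i \<le> v i" for i
  proof (induction i rule: dec_induct)
    case base
    then show ?case using mem[of 1] by simp
  next
    case (step i)
    then show ?case using inc[of i] by force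
  qed
  have upper: "i \<le> n \<Longrightarrow> 1 \<le> i \<Longrightarrow> v i \<le> i" for i
  proof (induction i rule: inc_induct)
    case base
    then show ?case using mem[of n] by simp
  next
    case (step i)
    then show ?case using inc[of i] by force
  qed
  show ?thesis
  proof
    fix i show "v i = id i"
      using lower[of i] upper[of i] v by (cases "i \<in> {1..n}") (auto simp: permutes_not_in)
  qed
qed

text \<open>Bubble sort: as long as the inverse is not increasing there is an adjacent descent, and
  removing it lowers the number of inversions by exactly one.\<close>

lemma ex_word_card_inversions:
  assumes "w permutes {1..n}"
  shows "\<exists>is. set is \<subseteq> {1..<n} \<and> word_perm is = w \<and> length is = card (inversions n w)"
  using assms
proof (induction "card (inversions n w)" arbitrary: w)
  case 0
  then have "inversions n w = {}" by simp
  then have "inv w i < inv w (Suc i)" if "i \<in> {1..<n}" for i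
    using that inv_permutes_neq[OF 0(2), of i]
    by (auto simp: inversions_def index_pairs_def linorder_neq_iff)
  with 0(2) have "inv w = id"
    by (intro permutes_increasing_imp_id permutes_inv)
  then have "w = id" using 0(2) by (metis inv_id permutes_inv_inv)
  then show ?case using 0 by (intro exI[of _ "[]"]) simp
next
  case (Suc k)
  have "\<exists>i\<in>{1..<n}. inv w (Suc i) < inv w i"
  proof (rule ccontr)
    assume "\<not> ?thesis"
    then have "inv w = id"
      using inv_permutes_neq[OF Suc(3)]
      by (intro permutes_increasing_imp_id[of _ n] permutes_inv Suc(3)) (meson linorder_neqE_nat)
    then have "inversions n w = {}" by (auto simp: inversions_def index_pairs_def)
    with Suc(2) show False by simp
  qed
  then obtain i where i: "i \<in> {1..<n}" and desc: "inv w (Suc i) < inv w i" by blast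
  let ?w = "simple_refl i \<circ> w"
  have card: "card (inversions n w) = Suc (card (inversions n ?w))"
    using i Suc(3) desc by (rule card_inversions_descent)
  have "\<exists>is. set is \<subseteq> {1..<n} \<and> word_perm is = ?w \<and> length is = card (inversions n ?w)"
    using Suc(1)[of ?w] card Suc(2,3) simple_refl_comp_permutes[OF i] by simp
  then obtain "is" where "set is \<subseteq> {1..<n}" "word_perm is = ?w" "length is = card (inversions n ?w)"
    by blast
  then show ?case using i card by (intro exI[of _ "i # is"]) simp
qed

text \<open>Sorting attains this number of letters, and no word does better because each letter
  creates at most one inversion.\<close>

lemma perm_length_eq_card_inversions:
  assumes "w permutes {1..n}"
  shows "perm_length n w = card (inversions n w)"
  unfolding perm_length_def
proof (rule Least_equality)
  show "\<exists>is. set is \<subseteq> {1..<n} \<and> word_perm is = w \<and> length is = card (inversions n w)"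
    using assms by (rule ex_word_card_inversions)
qed (use card_inversions_word_perm in blast)

lemma ex_reduced_word: "w permutes {1..n} \<Longrightarrow> \<exists>is. reduced_word n w is"
  unfolding reduced_word_def using ex_word_card_inversions perm_length_eq_card_inversions by simp

lemma perm_length_ascent:
  assumes "i \<in> {1..<n}" "w permutes {1..n}" "inv w i < inv w (Suc i)"
  shows "perm_length n (simple_refl i \<circ> w) = Suc (perm_length n w)"
  using assms card_inversions_ascent
  by (simp add: perm_length_eq_card_inversions simple_refl_comp_permutes)

lemma perm_length_descent:
  assumes "i \<in> {1..<n}" "w permutes {1..n}" "inv w (Suc i) < inv w i"
  shows "perm_length n w = Suc (perm_length n (simple_refl i \<circ> w))"
  using assms card_inversions_descent
  by (simp add: perm_length_eq_card_inversions simple_refl_comp_permutes)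

text \<open>The possible first letters of reduced words of w are exactly its left descents. This
  turns questions about reduced words into inequalities between values of
  \<open>inv w\<close>.\<close>

lemma reduced_word_Cons:
  assumes w: "w permutes {1..n}"
  shows "reduced_word n w (i # is) \<longleftrightarrow>
    i \<in> {1..<n} \<and> reduced_word n (simple_refl i \<circ> w) is \<and> inv w (Suc i) < inv w i" (is "?L \<longleftrightarrow> ?R")
proof
  assume L: ?L
  then have i: "i \<in> {1..<n}" and "is": "set is \<subseteq> {1..<n}"
    and wi: "simple_refl i \<circ> word_perm is = w" and len: "Suc (length is) = perm_length n w"
    by (auto simp: reduced_word_def)
  have wi': "simple_refl i \<circ> w = word_perm is" using wi by auto
  have "card (inversions n (simple_refl i \<circ> w)) \<le> length is"
    using card_inversions_word_perm[OF "is"] by (simp add: wi')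
  then have less: "perm_length n (simple_refl i \<circ> w) < perm_length n w"
    using len w i by (simp add: perm_length_eq_card_inversions simple_refl_comp_permutes)
  then have desc: "inv w (Suc i) < inv w i"
    using perm_length_ascent[OF i w] inv_permutes_neq[OF w, of i] by (metis linorder_neqE_nat not_less_eq less_Suc_eq)
  with perm_length_descent[OF i w] len i "is" wi' show ?R by (simp add: reduced_word_def)
next
  assume R: ?R
  then show ?L
    using perm_length_descent[of i n w] w by (auto simp: reduced_word_def)
qed

text \<open>Matsumoto's theorem, for operators on an arbitrary type. Induction on the length: if two
  reduced words start with different letters i and j, both letters are descents, so w has reduced
  words starting with either side of the braid or commutation relation, and these connect the two
  given words.\<close>

theorem reduced_word_braid_invariant:
  fixes T :: "nat \<Rightarrow> 'a \<Rightarrow> 'a"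
  assumes braid: "\<And>i x. i \<in> {1..<n} \<Longrightarrow> Suc i \<in> {1..<n} \<Longrightarrow>
      T i (T (Suc i) (T i x)) = T (Suc i) (T i (T (Suc i) x))"
    and commute: "\<And>i j x. i \<in> {1..<n} \<Longrightarrow> j \<in> {1..<n} \<Longrightarrow> Suc i < j \<Longrightarrow> T i (T j x) = T j (T i x)"
    and "w permutes {1..n}" "reduced_word n w is" "reduced_word n w js"
  shows "foldr T is x = foldr T js x"
  using assms(3-5)
proof (induction "perm_length n w" arbitrary: w "is" js)
  case 0
  then show ?case by (simp add: reduced_word_def)
next
  case (Suc k)
  note w = Suc.prems(1)
  obtain i is' where i: "is = i # is'" using Suc by (cases "is") (auto simp: reduced_word_def)
  obtain j js' where j: "js = j # js'" using Suc by (cases js) (auto simp: reduced_word_def)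
  \<comment> \<open>Words sharing their first letter are compared after deleting it.\<close>
  have IH: "foldr T us x = foldr T vs x"
    if "m \<in> {1..<n}" "reduced_word n w (m # us)" "reduced_word n w (m # vs)" for m us vs
  proof (rule Suc.hyps(1))
    show "k = perm_length n (simple_refl m \<circ> w)"
      using that Suc.hyps(2) perm_length_descent[OF that(1) w] reduced_word_Cons[OF w] by auto
    show "simple_refl m \<circ> w permutes {1..n}" using simple_refl_comp_permutes that(1) w .
  qed (use that reduced_word_Cons[OF w] in auto)
  have main: "T i (foldr T is' x) = T j (foldr T js' x)"
    if red: "reduced_word n w (i # is')" "reduced_word n w (j # js')" and "i < j" for i j is' js'
  proof -
    have i: "i \<in> {1..<n}" "inv w (Suc i) < inv w i" and j: "j \<in> {1..<n}" "inv w (Suc j) < inv w j"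
      using red reduced_word_Cons[OF w] by auto
    have bij: "bij w" using w by (rule permutes_bij)
    let ?s = simple_refl
    note perm = simple_refl_comp_permutes[OF i(1)] simple_refl_comp_permutes[OF j(1)]
    note red_simps = reduced_word_Cons perm w inv_simple_refl_comp bij_comp bij simple_refl_apply
    show ?thesis
    proof (cases "j = Suc i")
      case True
      \<comment> \<open>Since i and j are both descents, the whole longest element of the subgroup
        generated by s_i and s_j splits off w on the left, leaving this remainder.\<close>
      let ?v = "?s i \<circ> (?s j \<circ> (?s i \<circ> w))"
      have "?v permutes {1..n}" by (intro perm w)
      then obtain us where us: "reduced_word n ?v us" using ex_reduced_word by blast
      have v: "?v = ?s j \<circ> (?s i \<circ> (?s j \<circ> w))" using True simple_refl_braid by simp
      have 1: "reduced_word n w (i # j # i # us)"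
        using i j True us by (simp add: red_simps perm(2)[unfolded True])
      have 2: "reduced_word n w (j # i # j # us)"
        using i j True us unfolding v by (simp add: red_simps perm(2)[unfolded True])
      have "T i (foldr T is' x) = T i (T j (T i (foldr T us x)))"
        using IH[OF i(1) red(1) 1] by simp
      also have "\<dots> = T j (T i (T j (foldr T us x)))"
        using braid i j True by simp
      also have "\<dots> = T j (foldr T js' x)"
        using IH[OF j(1) red(2) 2] by simp
      finally show ?thesis .
    next
      case False
      with \<open>i < j\<close> have ij: "Suc i < j" by simp
      let ?v = "?s i \<circ> (?s j \<circ> w)"
      have "?v permutes {1..n}" by (intro perm w)
      then obtain us where us: "reduced_word n ?v us" using ex_reduced_word by blast
      have v: "?v = ?s j \<circ> (?s i \<circ> w)" by (rule simple_refl_commute[OF ij])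
      have 1: "reduced_word n w (i # j # us)"
        using i j ij us unfolding v by (simp add: red_simps)
      have 2: "reduced_word n w (j # i # us)"
        using i j ij us by (simp add: red_simps)
      show ?thesis
        using IH[OF i(1) red(1) 1] IH[OF j(1) red(2) 2] commute[OF i(1) j(1) ij] by simp
    qed
  qed
  show ?case
  proof (cases i j rule: linorder_cases)
    case less
    then show ?thesis using main Suc.prems i j by simp
  next
    case equal
    then show ?thesis using IH[of i is' js'] Suc.prems i j reduced_word_Cons[OF w] by auto
  next
    case greater
    then show ?thesis using main[of j js' i is'] Suc.prems i j by simp
  qed
qed

section \<open>The longest element\<close>

definition reversal :: "nat \<Rightarrow> nat \<Rightarrow> nat"
  where "reversal n i = (if i \<in> {1..n} then n + 1 - i else i)"

lemma reversal_reversal [simp]: "reversal n (reversal n i) = i"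
  by (auto simp: reversal_def)

lemma reversal_permutes: "reversal n permutes {1..n}"
  by (rule bij_imp_permutes[OF bij_betwI[where g = "reversal n"]]) (auto simp: reversal_def)

lemma inv_reversal [simp]: "inv (reversal n) = reversal n"
  by (rule inv_equality) simp_all

lemma inversions_reversal [simp]: "inversions n (reversal n) = index_pairs n"
  by (auto simp: inversions_def index_pairs_def reversal_def)

lemma perm_length_le: "w permutes {1..n} \<Longrightarrow> perm_length n w \<le> card (index_pairs n)"
  by (simp add: perm_length_eq_card_inversions card_mono inversions_subset)

lemma perm_length_reversal [simp]: "perm_length n (reversal n) = card (index_pairs n)"
  by (simp add: perm_length_eq_card_inversions reversal_permutes)

text \<open>The symmetrizers see \<open>longest n\<close> only through its length. The reversal
  inverts every pair, so it attains the largest possible number of inversions.\<close>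

lemma perm_length_longest: "perm_length n (longest n) = card (index_pairs n)"
proof -
  have "longest n permutes {1..n} \<and>
      (\<forall>w. w permutes {1..n} \<longrightarrow> perm_length n w \<le> perm_length n (longest n))"
    unfolding longest_def
    by (rule arg_max_nat_lemma[of _ "reversal n" _ "Suc (card (index_pairs n))"])
      (auto simp: reversal_permutes perm_length_le less_Suc_eq_le)
  then show ?thesis
    using perm_length_le perm_length_reversal reversal_permutes by (metis order_antisym)
qed

section \<open>Hecke operators as elements of the twisted group algebra\<close>

global_interpretation refl: ratfun_hom "perm_act (simple_refl i)" for i
  by (simp add: perm_act_hom)

lemma refl_X [simp]: "perm_act (simple_refl i) (X j) = X (simple_refl i j)"
  by (simp add: perm_act_X)

lemma refl_refl [simp]: "perm_act (simple_refl i) (perm_act (simple_refl i) z) = z"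
  by (simp flip: perm_act_comp)

text \<open>Different variables are different monomials. This makes factors such as t x_i - x_j
  cancellable later on.\<close>

lemma const_mult_X_neq:
  assumes "i \<noteq> j"
  shows "const a * X i \<noteq> X j"
proof
  assume "const a * X i = X j"
  moreover have "const a * X i = of_laurent (Poly_Mapping.single (Poly_Mapping.single i 1) a)"
    using of_laurent_single_add[of 0 "Poly_Mapping.single i 1" a 1] by (simp add: const_def X_def)
  ultimately have "of_laurent (Poly_Mapping.single (Poly_Mapping.single i 1) a) =
      of_laurent (Poly_Mapping.single (Poly_Mapping.single j 1) 1)"
    by (simp add: X_def)
  then have "Poly_Mapping.lookup (Poly_Mapping.single (Poly_Mapping.single i (1::int)) a) (Poly_Mapping.single j 1) =
      Poly_Mapping.lookup (Poly_Mapping.single (Poly_Mapping.single j (1::int)) (1::coeff_field)) (Poly_Mapping.single j 1)"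
    by (simp only: of_laurent_inject)
  moreover have "Poly_Mapping.single i (1::int) \<noteq> Poly_Mapping.single j 1"
    using assms by (metis keys_single singleton_inject zero_neq_one)
  ultimately show False by (simp add: lookup_single when_def)
qed

lemma thalf_nonzero [simp]: "thalf \<noteq> 0"
  by (simp add: thalf_def Zero_fract_def eq_fract)

lemma t_par_nonzero [simp]: "t_par \<noteq> 0"
  by (simp add: t_par_def)

text \<open>With j = i + 1, this and \<open>hecke_offdiag\<close> are the A_i and B_i of the
  overview. General index pairs are allowed so that a reflection acts on them by permuting the
  indices.\<close>

definition hecke_diag :: "nat \<Rightarrow> nat \<Rightarrow> ratfun"
  where "hecke_diag i j = (1 - const t_par) * X j / (X i - X j)"

definition hecke_offdiag :: "nat \<Rightarrow> nat \<Rightarrow> ratfun"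
  where "hecke_offdiag i j = (const t_par * X i - X j) / (X i - X j)"

lemma refl_hecke_coeffs [simp]:
  "perm_act (simple_refl k) (hecke_diag i j) = hecke_diag (simple_refl k i) (simple_refl k j)"
  "perm_act (simple_refl k) (hecke_offdiag i j) = hecke_offdiag (simple_refl k i) (simple_refl k j)"
  by (simp_all add: hecke_diag_def hecke_offdiag_def refl.homs)

lemma thalf_hecke:
  "const thalf * hecke i f =
    hecke_diag i (Suc i) * f + hecke_offdiag i (Suc i) * perm_act (simple_refl i) f"
proof -
  have alg: "h * (- inverse h * f + ((inverse h - h * inverse x * y) / (1 - inverse x * y) * f +
        (inverse h - h * inverse y * x) / (1 - inverse y * x) * g)) =
      (1 - h\<^sup>2) * y / (x - y) * f + (h\<^sup>2 * x - y) / (x - y) * g"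
    if "h \<noteq> 0" "x \<noteq> 0" "y \<noteq> 0" "x \<noteq> y" for h x y f g :: ratfun
  proof -
    have 1: "(inverse h - h * inverse x * y) / (1 - inverse x * y) = (x - h\<^sup>2 * y) / (h * (x - y))"
      using that by (simp add: divide_simps) (simp add: power2_eq_square algebra_simps)
    have 2: "(inverse h - h * inverse y * x) / (1 - inverse y * x) = (h\<^sup>2 * x - y) / (h * (x - y))"
      using that by (simp add: divide_simps) (simp add: power2_eq_square algebra_simps)
    show ?thesis unfolding 1 2
      using that by (simp add: divide_simps) (simp add: power2_eq_square algebra_simps)
  qed
  show ?thesis
    using alg[of "const thalf" "X i" "X (Suc i)" f "perm_act (simple_refl i) f"]
    by (simp add: hecke_def Let_def refl.homs hecke_diag_def hecke_offdiag_def t_par_def const_power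
        const_inverse simple_refl_apply)
qed

lemma hecke_const_mult: "hecke i (const c * f) = const c * hecke i f"
proof -
  have "const thalf * hecke i (const c * f) = const c *
      (hecke_diag i (Suc i) * f + hecke_offdiag i (Suc i) * perm_act (simple_refl i) f)"
    by (simp add: thalf_hecke refl.homs algebra_simps)
  also have "\<dots> = const thalf * (const c * hecke i f)"
    by (simp only: thalf_hecke[symmetric] mult.left_commute)
  finally show ?thesis by simp
qed

text \<open>A function \<open>F\<close> on permutations stands for the operator \<open>f \<mapsto> \<Sum>v. F v * perm_act v f\<close>;
  \<open>formal_hecke i\<close> is left multiplication by $t^{1/2}T_i$.\<close>

definition formal_hecke :: "nat \<Rightarrow> ((nat \<Rightarrow> nat) \<Rightarrow> ratfun) \<Rightarrow> (nat \<Rightarrow> nat) \<Rightarrow> ratfun"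
  where "formal_hecke i F w = hecke_diag i (Suc i) * F w +
    hecke_offdiag i (Suc i) * perm_act (simple_refl i) (F (simple_refl i \<circ> w))"

text \<open>Denominator-free forms, from which the identities below follow as polynomial
  identities.\<close>

lemma hecke_coeffs_mult:
  assumes "i \<noteq> j"
  shows "hecke_diag i j * (X i - X j) = (1 - const t_par) * X j"
    and "hecke_offdiag i j * (X i - X j) = const t_par * X i - X j"
  using assms by (simp_all add: hecke_diag_def hecke_offdiag_def)

lemma hecke_diag_swap:
  assumes "i \<noteq> j"
  shows "hecke_diag j i = const t_par - 1 - hecke_diag i j"
proof -
  have "(X i - X j) * (hecke_diag j i - (const t_par - 1 - hecke_diag i j)) = 0"
    using hecke_coeffs_mult(1)[OF assms] hecke_coeffs_mult(1)[OF assms[symmetric]] by algebra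
  then show ?thesis using assms by simp
qed

text \<open>For A = \<open>hecke_diag i j\<close> the two factors on the left are t - A and A + 1,
  and the right-hand side is their product.\<close>

lemma hecke_offdiag_swap:
  assumes "i \<noteq> j"
  shows "hecke_offdiag i j * hecke_offdiag j i =
    (const t_par - 1) * hecke_diag i j + const t_par - hecke_diag i j * hecke_diag i j"
proof -
  have "(X i - X j) * ((X i - X j) * (hecke_offdiag i j * hecke_offdiag j i -
      ((const t_par - 1) * hecke_diag i j + const t_par - hecke_diag i j * hecke_diag i j))) = 0"
    using hecke_coeffs_mult[OF assms] hecke_coeffs_mult(2)[OF assms[symmetric]] by algebra
  then show ?thesis using assms by simp
qed

text \<open>A partial fraction identity: the one relation involving three variables that the braid
  relation requires.\<close>

lemma hecke_diag_triple:
  assumes "i \<noteq> j" "j \<noteq> k" "i \<noteq> k"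
  shows "hecke_diag i j * hecke_diag j k + hecke_diag i k * (const t_par - 1) =
    hecke_diag i k * (hecke_diag i j + hecke_diag j k)"
proof -
  have "(X i - X j) * ((X j - X k) * ((X i - X k) *
      (hecke_diag i j * hecke_diag j k + hecke_diag i k * (const t_par - 1) -
        hecke_diag i k * (hecke_diag i j + hecke_diag j k)))) = 0"
    using hecke_coeffs_mult(1)[OF assms(1)] hecke_coeffs_mult(1)[OF assms(2)] hecke_coeffs_mult(1)[OF assms(3)]
    by algebra
  then show ?thesis using assms by simp
qed

lemma formal_hecke_braid:
  "formal_hecke i (formal_hecke (Suc i) (formal_hecke i F)) =
   formal_hecke (Suc i) (formal_hecke i (formal_hecke (Suc i) F))"
proof
  fix w
  have braid: "perm_act (simple_refl i) (perm_act (simple_refl (Suc i)) (perm_act (simple_refl i) z)) =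
      perm_act (simple_refl (Suc i)) (perm_act (simple_refl i) (perm_act (simple_refl (Suc i)) z))" for z
    using simple_refl_braid[of i id] by (simp add: bij_comp flip: perm_act_comp)
  \<comment> \<open>From here on only the action on indices and the relations just listed are used,
    so the coefficients are kept as opaque symbols.\<close>
  define A B where "A = hecke_diag" and "B = hecke_offdiag"
  let ?j = "Suc i" and ?k = "Suc (Suc i)"
  note AB = refl_hecke_coeffs[folded A_def B_def]
  have A: "A ?j i = const t_par - 1 - A i ?j" "A ?k ?j = const t_par - 1 - A ?j ?k"
    and B: "B i ?j * B ?j i = (const t_par - 1) * A i ?j + const t_par - A i ?j * A i ?j"
      "B ?j ?k * B ?k ?j = (const t_par - 1) * A ?j ?k + const t_par - A ?j ?k * A ?j ?k"
    and triple: "A i ?j * A ?j ?k + A i ?k * (const t_par - 1) = A i ?k * (A i ?j + A ?j ?k)"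
    by (simp_all add: A_def B_def hecke_diag_swap[of i ?j] hecke_diag_swap[of ?j ?k]
        hecke_offdiag_swap hecke_diag_triple)
  let ?s = "\<lambda>i. perm_act (simple_refl i)"
  let ?o = "\<lambda>i w. simple_refl i \<circ> w"
  \<comment> \<open>The values of F at the six elements of the coset of w under s_i and s_{i+1},
    each with its reflections applied. Both sides become linear forms in these six quantities, with
    coefficients polynomial in A and B.\<close>
  define e0 e1 e2 e3 e4 e5 where e: "e0 = F w" "e1 = ?s i (F (?o i w))" "e2 = ?s ?j (F (?o ?j w))"
    "e3 = ?s i (?s ?j (F (?o ?j (?o i w))))" "e4 = ?s ?j (?s i (F (?o i (?o ?j w))))"
    "e5 = ?s ?j (?s i (?s ?j (F (?o ?j (?o i (?o ?j w))))))"
  have L: "formal_hecke i (formal_hecke ?j (formal_hecke i F)) w =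
      A i ?j * (A ?j ?k * (A i ?j * e0 + B i ?j * e1) + B ?j ?k * (A i ?k * e2 + B i ?k * e4)) +
      B i ?j * (A i ?k * (A ?j i * e1 + B ?j i * e0) + B i ?k * (A ?j ?k * e3 + B ?j ?k * e5))"
    unfolding formal_hecke_def e A_def[symmetric] B_def[symmetric]
    by (simp add: refl.homs AB simple_refl_apply braid simple_refl_braid)
  have R: "formal_hecke ?j (formal_hecke i (formal_hecke ?j F)) w =
      A ?j ?k * (A i ?j * (A ?j ?k * e0 + B ?j ?k * e2) + B i ?j * (A i ?k * e1 + B i ?k * e3)) +
      B ?j ?k * (A i ?k * (A ?k ?j * e2 + B ?k ?j * e0) + B i ?k * (A i ?j * e4 + B i ?j * e5))"
    unfolding formal_hecke_def e A_def[symmetric] B_def[symmetric]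
    by (simp add: refl.homs AB simple_refl_apply)
  show "formal_hecke i (formal_hecke ?j (formal_hecke i F)) w =
      formal_hecke ?j (formal_hecke i (formal_hecke ?j F)) w"
    unfolding L R using A B triple by algebra
qed

lemma formal_hecke_commute:
  assumes "Suc i < j"
  shows "formal_hecke i (formal_hecke j F) = formal_hecke j (formal_hecke i F)"
proof
  fix w
  have "perm_act (simple_refl i) (perm_act (simple_refl j) z) =
      perm_act (simple_refl j) (perm_act (simple_refl i) z)" for z
    using simple_refl_commute[OF assms, of id] by (simp add: bij_comp flip: perm_act_comp)
  then show "formal_hecke i (formal_hecke j F) w = formal_hecke j (formal_hecke i F) w"
    using assms unfolding formal_hecke_def simple_refl_commute[OF assms]
    by (simp add: refl.homs simple_refl_apply algebra_simps)
qed

text \<open>By \<open>hecke_diag_swap\<close> the two diagonal entries met by the reflected term add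
  up to t - 1, and \<open>hecke_offdiag_swap\<close> supplies the matching coefficient of F w. In
  factored form the relation is (T - t)(T + 1) = 0.\<close>

lemma formal_hecke_quadratic:
  "formal_hecke i (formal_hecke i F) w = (const t_par - 1) * formal_hecke i F w + const t_par * F w"
proof -
  define A B where "A = hecke_diag" and "B = hecke_offdiag"
  note AB = refl_hecke_coeffs[folded A_def B_def]
  let ?j = "Suc i"
  have 1: "A ?j i = const t_par - 1 - A i ?j"
    and 2: "B i ?j * B ?j i = (const t_par - 1) * A i ?j + const t_par - A i ?j * A i ?j"
    by (simp_all add: A_def B_def hecke_diag_swap[of i ?j] hecke_offdiag_swap)
  have "formal_hecke i (formal_hecke i F) w =
      A i ?j * (A i ?j * F w + B i ?j * perm_act (simple_refl i) (F (simple_refl i \<circ> w))) +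
      B i ?j * (A ?j i * perm_act (simple_refl i) (F (simple_refl i \<circ> w)) + B ?j i * F w)"
    unfolding formal_hecke_def A_def[symmetric] B_def[symmetric]
    by (simp add: refl.homs AB simple_refl_apply)
  moreover have "formal_hecke i F w =
      A i ?j * F w + B i ?j * perm_act (simple_refl i) (F (simple_refl i \<circ> w))"
    by (simp add: formal_hecke_def A_def B_def)
  ultimately show ?thesis using 1 2 by algebra
qed

lemma formal_hecke_sum:
  "formal_hecke i (\<lambda>v. \<Sum>a\<in>A. const (c a) * F a v) w = (\<Sum>a\<in>A. const (c a) * formal_hecke i (F a) w)"
  by (simp add: formal_hecke_def refl.homs sum_distrib_left sum.distrib algebra_simps)

lemma formal_hecke_add:
  "formal_hecke i (\<lambda>v. F v + const c * G v) w = formal_hecke i F w + const c * formal_hecke i G w"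
  by (simp add: formal_hecke_def refl.homs algebra_simps)

section \<open>Coefficient functions of the T_w and of their signed sums\<close>

definition formal_one :: "(nat \<Rightarrow> nat) \<Rightarrow> ratfun"
  where "formal_one v = (if v = id then 1 else 0)"

text \<open>The chosen reduced word is the same as in \<open>hecke_perm\<close>, so the two can be
  compared letter by letter.\<close>

definition formal_hecke_perm :: "nat \<Rightarrow> (nat \<Rightarrow> nat) \<Rightarrow> (nat \<Rightarrow> nat) \<Rightarrow> ratfun"
  where "formal_hecke_perm n w = foldr formal_hecke (SOME is. reduced_word n w is) formal_one"

lemma some_reduced_word:
  "w permutes {1..n} \<Longrightarrow> reduced_word n w (SOME is. reduced_word n w is)"
  using ex_reduced_word by (rule someI_ex)

text \<open>The word chosen for s_i w need not be the one chosen for w with i in front. Both are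
  reduced, and the braid relations make the result independent of the choice.\<close>

lemma formal_hecke_ascent:
  assumes i: "i \<in> {1..<n}" and w: "w permutes {1..n}" and asc: "inv w i < inv w (Suc i)"
  shows "formal_hecke i (formal_hecke_perm n w) = formal_hecke_perm n (simple_refl i \<circ> w)"
proof -
  let ?w = "simple_refl i \<circ> w"
  have w': "?w permutes {1..n}" using i w by (rule simple_refl_comp_permutes)
  have "reduced_word n ?w (i # (SOME is. reduced_word n w is))"
    using reduced_word_Cons[OF w'] some_reduced_word[OF w] i asc w
    by (simp add: inv_simple_refl_comp permutes_bij simple_refl_apply)
  then have "foldr formal_hecke (i # (SOME is. reduced_word n w is)) formal_one =
      foldr formal_hecke (SOME is. reduced_word n ?w is) formal_one"
    by (intro reduced_word_braid_invariant[where T = formal_hecke, OF _ _ w' _ some_reduced_word[OF w']])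
      (rule formal_hecke_braid, rule formal_hecke_commute)
  then show ?thesis by (simp add: formal_hecke_perm_def)
qed

text \<open>$\sum_w \beta^{\ell(w)} t^{\ell(w)/2} T_w$; the two symmetrizers are multiples of the cases
  $\beta = 1$ and $\beta = -t^{-1}$.\<close>

definition formal_symmetrizer :: "nat \<Rightarrow> coeff_field \<Rightarrow> (nat \<Rightarrow> nat) \<Rightarrow> ratfun"
  where "formal_symmetrizer n \<beta> v =
    (\<Sum>w | w permutes {1..n}. const (\<beta> ^ perm_length n w) * formal_hecke_perm n w v)"

text \<open>Pairing each w that has i as an ascent with s_i w writes the sum as a combination of
  terms (1 + \<beta> T) applied to \<open>formal_hecke_perm n w\<close>, where T is
  \<open>formal_hecke i\<close>. By the quadratic relation each such term is an eigenvector.\<close>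

lemma formal_hecke_symmetrizer:
  assumes i: "i \<in> {1..<n}" and \<beta>: "\<beta> = 1 \<or> \<beta> * t_par = -1"
  shows "formal_hecke i (formal_symmetrizer n \<beta>) v = const (\<beta> * t_par) * formal_symmetrizer n \<beta> v"
proof -
  let ?s = "\<lambda>w. simple_refl i \<circ> w"
  define P where "P = {w. w permutes {1..n}}"
  define A where "A = {w \<in> P. inv w i < inv w (Suc i)}"
  have fin: "finite P" "finite A" by (simp_all add: P_def A_def finite_permutations)
  have perm: "?s w \<in> P" if "w \<in> P" for w
    using that i simple_refl_comp_permutes by (simp add: P_def)
  have D: "?s ` A = P - A"
  proof (intro equalityI subsetI)
    fix w assume "w \<in> ?s ` A"
    then show "w \<in> P - A"
      using perm by (auto simp: A_def P_def inv_simple_refl_comp permutes_bij simple_refl_apply simp del: o_apply)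
        (simp add: inv_simple_refl_comp permutes_bij simple_refl_apply)
  next
    fix w assume w: "w \<in> P - A"
    then have "inv w (Suc i) < inv w i"
      using inv_permutes_neq[of w n i] by (auto simp: A_def P_def)
    then have "?s w \<in> A"
      using w perm[of w] by (simp add: A_def P_def inv_simple_refl_comp permutes_bij simple_refl_apply)
    then show "w \<in> ?s ` A" by (rule rev_image_eqI) simp
  qed
  have inj: "inj_on ?s A"
    by (metis (no_types, lifting) inj_onI simple_refl_comp(2))
  let ?b = "\<lambda>w. \<beta> ^ perm_length n w"
  let ?G = "\<lambda>w v. formal_hecke_perm n w v + const \<beta> * formal_hecke i (formal_hecke_perm n w) v"
  have S: "formal_symmetrizer n \<beta> = (\<lambda>v. \<Sum>w\<in>A. const (?b w) * ?G w v)"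
  proof
    fix v
    have "formal_symmetrizer n \<beta> v = (\<Sum>w\<in>P - A. const (?b w) * formal_hecke_perm n w v) +
        (\<Sum>w\<in>A. const (?b w) * formal_hecke_perm n w v)"
      unfolding formal_symmetrizer_def P_def[symmetric]
      by (rule sum.subset_diff) (use fin in \<open>auto simp: A_def\<close>)
    also have "(\<Sum>w\<in>P - A. const (?b w) * formal_hecke_perm n w v) =
        (\<Sum>w\<in>A. const (?b (?s w)) * formal_hecke_perm n (?s w) v)"
      unfolding D[symmetric] unfolding sum.reindex[OF inj] by (rule sum.cong) (simp_all only: o_apply)
    also have "\<dots> = (\<Sum>w\<in>A. const (?b w) * (const \<beta> * formal_hecke i (formal_hecke_perm n w) v))"
      by (rule sum.cong)
        (use i in \<open>auto simp: A_def P_def perm_length_ascent formal_hecke_ascent const_mult mult.assoc mult.left_commute\<close>)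
    finally show "formal_symmetrizer n \<beta> v = (\<Sum>w\<in>A. const (?b w) * ?G w v)"
      by (simp add: sum.distrib[symmetric] distrib_left add.commute)
  qed
  \<comment> \<open>This is (\<beta> - 1)(\<beta> t + 1) = 0, the origin of the two admissible
    values of \<beta>.\<close>
  have \<beta>': "1 + \<beta> * (t_par - 1) = \<beta> * t_par * \<beta>"
    using \<beta> by (elim disjE) (simp, algebra)
  have eig: "formal_hecke i (?G w) v = const (\<beta> * t_par) * ?G w v" for w
  proof -
    have "formal_hecke i (?G w) v = const (1 + \<beta> * (t_par - 1)) * formal_hecke i (formal_hecke_perm n w) v
        + const (\<beta> * t_par) * formal_hecke_perm n w v"
      by (simp add: formal_hecke_add formal_hecke_quadratic const_add const_mult const_diff algebra_simps)
    then show ?thesis unfolding \<beta>' by (simp add: const_mult algebra_simps)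
  qed
  show ?thesis
    unfolding S formal_hecke_sum eig by (simp add: sum_distrib_left mult.left_commute)
qed

text \<open>Expanding a word yields only products of its subwords, and a proper subword is too short
  to produce that many inversions. In the recursion, the coefficient at v meets those of the shorter
  word at v and at s_i v, and both again satisfy the hypotheses.\<close>

lemma formal_hecke_word_eq_0:
  assumes "set is \<subseteq> {1..<n}" "v permutes {1..n}" "length is \<le> card (inversions n v)" "v \<noteq> word_perm is"
  shows "foldr formal_hecke is formal_one v = 0"
  using assms
proof (induction "is" arbitrary: v)
  case Nil
  then have "v \<noteq> id" by (metis word_perm_simps(1))
  then show ?case by (simp add: formal_one_def)
next
  case (Cons i "is")
  then have i: "i \<in> {1..<n}" and "is": "set is \<subseteq> {1..<n}" by auto
  have "v \<noteq> word_perm is"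
    using card_inversions_word_perm[OF "is"] Cons.prems(3) by auto
  with Cons have 1: "foldr formal_hecke is formal_one v = 0" by simp
  have 2: "foldr formal_hecke is formal_one (simple_refl i \<circ> v) = 0"
  proof (rule Cons.IH)
    show "simple_refl i \<circ> v permutes {1..n}" using i Cons.prems(2) by (rule simple_refl_comp_permutes)
    show "length is \<le> card (inversions n (simple_refl i \<circ> v))"
      using card_inversions_simple_refl_le(1)[OF i Cons.prems(2)] Cons.prems(3) by simp
    show "simple_refl i \<circ> v \<noteq> word_perm is"
      using Cons.prems(4) by (metis simple_refl_comp(2) word_perm_simps(2))
  qed (rule "is")
  show ?case using 1 2 by (simp add: formal_hecke_def[of i "foldr formal_hecke is formal_one"])
qed

text \<open>The diagonal term vanishes because the shorter word cannot reach w. Each letter thus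
  contributes one off-diagonal factor and reflects the indices of the earlier ones, which is exactly
  how the inversion set grows.\<close>

lemma formal_hecke_word_leading:
  assumes "w permutes {1..n}" "reduced_word n w is"
  shows "foldr formal_hecke is formal_one w = (\<Prod>(i, j)\<in>inversions n w. hecke_offdiag i j)"
  using assms
proof (induction "is" arbitrary: w)
  case Nil
  then have "w = id" by (simp add: reduced_word_def del: id_apply)
  moreover have "inversions n id = {}" by (auto simp: inversions_def index_pairs_def)
  moreover have "foldr formal_hecke [] formal_one id = 1" by (simp add: formal_one_def)
  ultimately show ?case by (metis prod.empty)
next
  case (Cons i "is")
  define u where "u = simple_refl i \<circ> w"
  have red: "i \<in> {1..<n}" "reduced_word n u is" and desc: "inv w (Suc i) < inv w i"
    using Cons.prems reduced_word_Cons by (auto simp: u_def simp del: o_apply)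
  have u: "u permutes {1..n}" unfolding u_def using red(1) Cons.prems(1) by (rule simple_refl_comp_permutes)
  have w: "w = simple_refl i \<circ> u" by (simp add: u_def)
  have asc: "inv u i < inv u (Suc i)"
    using desc Cons.prems(1) by (simp add: u_def inv_simple_refl_comp permutes_bij simple_refl_apply)
  have "is": "set is \<subseteq> {1..<n}" "length is = perm_length n u"
    using red(2) by (auto simp: reduced_word_def)
  have len: "length is < card (inversions n w)"
    using card_inversions_ascent[OF red(1) u asc] "is"(2) u by (simp add: w perm_length_eq_card_inversions)
  then have "w \<noteq> word_perm is"
    using card_inversions_word_perm[OF "is"(1)] by auto
  then have 0: "foldr formal_hecke is formal_one w = 0"
    using "is"(1) Cons.prems(1) len by (intro formal_hecke_word_eq_0) auto
  have inj: "inj_on (map_prod (simple_refl i) (simple_refl i)) A" for A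
    by (rule inj_on_subset[OF _ subset_UNIV]) (intro prod.inj_map bij_is_inj bij_simple_refl)
  have "foldr formal_hecke (i # is) formal_one w =
      hecke_offdiag i (Suc i) * perm_act (simple_refl i) (foldr formal_hecke is formal_one u)"
    using 0 by (simp add: formal_hecke_def[of i "foldr formal_hecke is formal_one"] u_def)
  also have "\<dots> = hecke_offdiag i (Suc i) *
      (\<Prod>(a, b)\<in>inversions n u. hecke_offdiag (simple_refl i a) (simple_refl i b))"
    unfolding Cons.IH[OF u red(2)] by (simp add: refl.homs case_prod_unfold)
  also have "\<dots> = hecke_offdiag i (Suc i) *
      (\<Prod>(a, b)\<in>map_prod (simple_refl i) (simple_refl i) ` inversions n u. hecke_offdiag a b)"
    by (subst prod.reindex[OF inj]) (simp add: case_prod_unfold)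
  also have "\<dots> = (\<Prod>(a, b)\<in>inversions n w. hecke_offdiag a b)"
    unfolding w inversions_simple_refl_comp(1)[OF red(1) u asc]
    by (subst prod.insert) (use inversions_simple_refl_comp(2)[OF red(1) u asc] in auto)
  finally show ?case .
qed

lemma formal_symmetrizer_reversal:
  "formal_symmetrizer n \<beta> (reversal n) =
    const (\<beta> ^ card (index_pairs n)) * (\<Prod>(i, j)\<in>index_pairs n. hecke_offdiag i j)"
proof -
  have "formal_hecke_perm n w (reversal n) = 0" if w: "w permutes {1..n}" "w \<noteq> reversal n" for w
    unfolding formal_hecke_perm_def
  proof (rule formal_hecke_word_eq_0[of _ n])
    note red = some_reduced_word[OF w(1), unfolded reduced_word_def[of n w "SOME is. reduced_word n w is"]]
    show "set (SOME is. reduced_word n w is) \<subseteq> {1..<n}" using red by blast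
    show "length (SOME is. reduced_word n w is) \<le> card (inversions n (reversal n))"
      using red perm_length_le[OF w(1)] by simp
    show "reversal n \<noteq> word_perm (SOME is. reduced_word n w is)" using red w(2) by metis
  qed (rule reversal_permutes)
  then have "formal_symmetrizer n \<beta> (reversal n) = (\<Sum>w\<in>{reversal n}.
      const (\<beta> ^ perm_length n w) * formal_hecke_perm n w (reversal n))"
    unfolding formal_symmetrizer_def
    by (intro sum.mono_neutral_right) (auto simp: finite_permutations reversal_permutes)
  also have "\<dots> = const (\<beta> ^ card (index_pairs n)) * (\<Prod>(i, j)\<in>index_pairs n. hecke_offdiag i j)"
    using formal_hecke_word_leading[OF reversal_permutes some_reduced_word[OF reversal_permutes], of n]
    by (simp add: formal_hecke_perm_def)
  finally show ?thesis .
qed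

section \<open>The symmetrizers as sums over permutations\<close>

text \<open>Simple reflections generate the group, so everything is determined by the value at the
  identity. Since the reversal is an involution, it recovers that value from the coefficient at the
  reversal, the one known explicitly.\<close>

lemma perm_invariant_family:
  assumes inv: "\<And>i v. i \<in> {1..<n} \<Longrightarrow> v permutes {1..n} \<Longrightarrow>
      Y v = perm_act (simple_refl i) (Y (simple_refl i \<circ> v))"
    and v: "v permutes {1..n}"
  shows "Y v = perm_act v (perm_act (reversal n) (Y (reversal n)))"
proof -
  have Y: "Y v = perm_act v (Y id)" if v: "v permutes {1..n}" for v
  proof -
    have "Y (word_perm is) = perm_act (word_perm is) (Y id)" if "set is \<subseteq> {1..<n}" for "is"
      using that
    proof (induction "is")
      case Nil
      then show ?case by (metis perm_act_id word_perm_simps(1))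
    next
      case (Cons i "is")
      then have i: "i \<in> {1..<n}" and w: "word_perm is permutes {1..n}"
        using word_perm_permutes by auto
      have "Y (word_perm (i # is)) = perm_act (simple_refl i) (Y (word_perm is))"
        using inv[OF i simple_refl_comp_permutes[OF i w]] by (metis simple_refl_comp(2) word_perm_simps(2))
      also have "\<dots> = perm_act (word_perm (i # is)) (Y id)"
        using Cons perm_act_comp[OF bij_simple_refl permutes_bij[OF w]]
        by (metis insert_subset list.simps(15) word_perm_simps(2))
      finally show ?case .
    qed
    then show ?thesis using ex_reduced_word[OF v] by (auto simp: reduced_word_def)
  qed
  have "perm_act (reversal n) (Y (reversal n)) = perm_act (reversal n \<circ> reversal n) (Y id)"
    using Y[OF reversal_permutes] perm_act_comp permutes_bij[OF reversal_permutes] by metis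
  also have "reversal n \<circ> reversal n = id" by (auto simp: fun_eq_iff)
  finally show ?thesis using Y[OF v] by (simp only: perm_act_id)
qed

lemma reversal_index_pairs:
  "bij_betw (\<lambda>(i, j). (reversal n j, reversal n i)) (index_pairs n) (index_pairs n)"
  by (rule bij_betwI[where g = "\<lambda>(i, j). (reversal n j, reversal n i)"])
    (auto simp: index_pairs_def reversal_def)

lemma formal_symmetrizer_bosonic:
  assumes "v permutes {1..n}"
  shows "formal_symmetrizer n 1 v =
    perm_act v (\<Prod>(i, j)\<in>index_pairs n. (X i - const t_par * X j) / (X i - X j))"
proof -
  interpret r: ratfun_hom "perm_act (reversal n)"
    by (rule perm_act_hom[OF permutes_bij[OF reversal_permutes]])
  have "formal_symmetrizer n 1 v = perm_act (simple_refl i) (formal_symmetrizer n 1 (simple_refl i \<circ> v))"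
    if i: "i \<in> {1..<n}" and v: "v permutes {1..n}" for i v
  proof -
    let ?S = "formal_symmetrizer n 1"
    have "hecke_diag i (Suc i) * ?S v + hecke_offdiag i (Suc i) * perm_act (simple_refl i) (?S (simple_refl i \<circ> v)) =
        const t_par * ?S v"
      using formal_hecke_symmetrizer[OF i, of 1 v] by (simp add: formal_hecke_def)
    \<comment> \<open>For the eigenvalue t the eigenvector equation therefore has the same
      coefficient on both sides, and cancelling it leaves plain invariance.\<close>
    moreover have "const t_par - hecke_diag i (Suc i) = hecke_offdiag i (Suc i)"
      by (simp add: hecke_diag_def hecke_offdiag_def field_simps)
    ultimately have "hecke_offdiag i (Suc i) * ?S v =
        hecke_offdiag i (Suc i) * perm_act (simple_refl i) (?S (simple_refl i \<circ> v))"
      by algebra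
    moreover have "hecke_offdiag i (Suc i) \<noteq> 0"
      using const_mult_X_neq[of i "Suc i"] by (simp add: hecke_offdiag_def)
    ultimately show ?thesis by simp
  qed
  from perm_invariant_family[of n "formal_symmetrizer n 1", OF this assms]
  have "formal_symmetrizer n 1 v =
      perm_act v (perm_act (reversal n) (\<Prod>(i, j)\<in>index_pairs n. hecke_offdiag i j))"
    by (simp add: formal_symmetrizer_reversal)
  also have "perm_act (reversal n) (\<Prod>(i, j)\<in>index_pairs n. hecke_offdiag i j) =
      (\<Prod>p\<in>index_pairs n. (\<lambda>(i, j). (X i - const t_par * X j) / (X i - X j))
        ((\<lambda>(i, j). (reversal n j, reversal n i)) p))"
  proof -
    \<comment> \<open>Reversal turns the pair around, so numerator and denominator are both negated
      to restore increasing indices.\<close>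
    have "perm_act (reversal n) (hecke_offdiag i j) =
        (X (reversal n j) - const t_par * X (reversal n i)) / (X (reversal n j) - X (reversal n i))" for i j
      unfolding hecke_offdiag_def
      by (simp add: r.homs perm_act_X)
        (metis minus_diff_eq minus_divide_divide)
    then show ?thesis by (simp add: r.homs case_prod_unfold)
  qed
  also have "\<dots> = (\<Prod>(i, j)\<in>index_pairs n. (X i - const t_par * X j) / (X i - X j))"
    by (rule prod.reindex_bij_betw[OF reversal_index_pairs])
  finally show ?thesis .
qed

section \<open>The fermionic prefactor and the sign-twisted coefficients\<close>

definition fermionic_factor :: "nat \<Rightarrow> ratfun"
  where "fermionic_factor n = (\<Prod>(i, j) \<in> index_pairs n. (X j - const t_par * X i) / (X i - X j))"

lemma X_minus_const_mult_X: "i \<noteq> j \<Longrightarrow> X i - const t_par * X j \<noteq> 0"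
  using const_mult_X_neq[of j i t_par] by simp

lemma fermionic_factor_nonzero: "fermionic_factor n \<noteq> 0"
  unfolding fermionic_factor_def
  by (subst prod_zero_iff[OF finite_index_pairs])
    (auto simp: index_pairs_def const_mult_X_neq[symmetric])

lemma fermionic_factor_hecke_offdiag:
  "(\<Prod>(i, j)\<in>index_pairs n. hecke_offdiag i j) = (-1) ^ card (index_pairs n) * fermionic_factor n"
proof -
  have "(\<Prod>(i, j)\<in>index_pairs n. hecke_offdiag i j) =
      (\<Prod>p\<in>index_pairs n. (-1) * (case p of (i, j) \<Rightarrow> (X j - const t_par * X i) / (X i - X j)))"
    unfolding hecke_offdiag_def mult_minus1 case_prod_unfold
    by (intro prod.cong refl) (metis minus_diff_eq minus_divide_left)
  then show ?thesis
    unfolding prod.distrib prod_constant fermionic_factor_def .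
qed

text \<open>The reflection permutes all factors except the one for (i, i + 1), so only that factor
  changes. Clearing denominators gives the stated form.\<close>

lemma fermionic_factor_refl:
  assumes i: "i \<in> {1..<n}"
  shows "(X (Suc i) - const t_par * X i) * perm_act (simple_refl i) (fermionic_factor n) =
    - (X i - const t_par * X (Suc i)) * fermionic_factor n"
proof -
  let ?s = "map_prod (simple_refl i) (simple_refl i)"
  let ?f = "\<lambda>(i, j). (X j - const t_par * X i) / (X i - X j)"
  let ?I = "index_pairs n - {(i, Suc i)}"
  have mem: "(i, Suc i) \<in> index_pairs n" using i by (simp add: index_pairs_def)
  define Q where "Q = prod ?f ?I"
  have D: "fermionic_factor n = (X (Suc i) - const t_par * X i) / (X i - X (Suc i)) * Q"
    unfolding fermionic_factor_def Q_def by (subst prod.remove[OF finite_index_pairs mem]) simp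
  have "bij_betw ?s ?I ?I"
    by (rule bij_betwI[where g = ?s])
      (use simple_refl_index_pairs[OF i] in \<open>auto simp del: Diff_iff simp: map_prod_def split_def\<close>)
  then have "(\<Prod>p\<in>?I. ?f (?s p)) = prod ?f ?I"
    by (rule prod.reindex_bij_betw)
  moreover have "perm_act (simple_refl i) (prod ?f ?I) = (\<Prod>p\<in>?I. ?f (?s p))"
    by (simp add: refl.homs case_prod_unfold)
  ultimately have inv: "perm_act (simple_refl i) Q = Q" by (simp only: Q_def)
  have *: "X (Suc i) - X i \<noteq> 0" "X i - X (Suc i) \<noteq> 0" by auto
  show ?thesis
    unfolding D using * by (simp add: refl.homs inv simple_refl_apply divide_simps) algebra
qed

text \<open>Dividing by the prefactor and by the sign of v turns the eigenvector equation for -1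
  into plain invariance, so the argument of the bosonic case applies to the quotient
  \<open>Y\<close>.\<close>

lemma formal_symmetrizer_fermionic:
  assumes v: "v permutes {1..n}"
  shows "const ((- t_par) ^ card (index_pairs n)) * formal_symmetrizer n (- inverse t_par) v =
    (-1) ^ perm_length n v * fermionic_factor n"
proof -
  let ?S = "formal_symmetrizer n (- inverse t_par)" and ?D = "fermionic_factor n"
  define Y where "Y v = (-1) ^ perm_length n v * ?S v / ?D" for v
  interpret r: ratfun_hom "perm_act (reversal n)"
    by (rule perm_act_hom[OF permutes_bij[OF reversal_permutes]])
  interpret v: ratfun_hom "perm_act v"
    by (rule perm_act_hom[OF permutes_bij[OF v]])
  have "Y v = perm_act (simple_refl i) (Y (simple_refl i \<circ> v))"
    if i: "i \<in> {1..<n}" and v: "v permutes {1..n}" for i v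
  proof -
    let ?x = "X i" and ?y = "X (Suc i)" and ?t = "const t_par"
    define a b d where "a = ?S v" and "b = perm_act (simple_refl i) (?S (simple_refl i \<circ> v))"
      and "d = perm_act (simple_refl i) ?D"
    have sign: "(-1) ^ perm_length n (simple_refl i \<circ> v) = - ((-1) ^ perm_length n v :: ratfun)"
      using perm_length_ascent[OF i v] perm_length_descent[OF i v] inv_permutes_neq[OF v, of i]
      by (cases "inv v i < inv v (Suc i)") (simp_all del: o_apply)
    have "hecke_diag i (Suc i) * a + hecke_offdiag i (Suc i) * b = - a"
      using formal_hecke_symmetrizer[OF i, of "- inverse t_par" v]
      by (simp add: formal_hecke_def a_def b_def const_uminus)
    \<comment> \<open>Here A + 1 = (x - t y)/(x - y) and B = -(y - t x)/(x - y).\<close>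
    then have "(?x - ?t * ?y) * a = (?y - ?t * ?x) * b"
      using hecke_coeffs_mult[of i "Suc i"] by simp algebra
    moreover have "(?y - ?t * ?x) * d = - (?x - ?t * ?y) * ?D"
      unfolding d_def by (rule fermionic_factor_refl[OF i])
    ultimately have "(?y - ?t * ?x) * ((?x - ?t * ?y) * (a * d + b * ?D)) = 0"
      by algebra
    then have "a * d = - b * ?D"
      using X_minus_const_mult_X[of i "Suc i"] X_minus_const_mult_X[of "Suc i" i]
      by (simp add: eq_neg_iff_add_eq_0)
    then have eq: "a / ?D = - (b / d)"
      using fermionic_factor_nonzero by (simp add: d_def field_simps)
    have 1: "Y v = (-1) ^ perm_length n v * (a / ?D)"
      by (simp add: Y_def a_def)
    have 2: "perm_act (simple_refl i) (Y (simple_refl i \<circ> v)) = - ((-1) ^ perm_length n v) * (b / d)"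
      by (simp add: Y_def sign refl.homs b_def d_def del: o_apply)
    show ?thesis unfolding 1 2 eq by (simp only: mult_minus_left mult_minus_right)
  qed
  from perm_invariant_family[of n Y, OF this v]
  have "Y v = perm_act v (perm_act (reversal n) (Y (reversal n)))" .
  \<comment> \<open>The sign of the reversal cancels the sign by which the product of off-diagonal
    coefficients differs from the prefactor.\<close>
  moreover have "Y (reversal n) = const ((- inverse t_par) ^ card (index_pairs n))"
    using fermionic_factor_nonzero
    by (simp add: Y_def formal_symmetrizer_reversal fermionic_factor_hecke_offdiag
        mult.left_commute flip: power_add mult_2)
  ultimately have "Y v = const ((- inverse t_par) ^ card (index_pairs n))"
    by (simp add: r.const v.const)
  then have "const ((- t_par) ^ card (index_pairs n)) * Y v = 1"
    by (simp flip: const_mult power_mult_distrib)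
  moreover define l :: ratfun where "l = (-1) ^ perm_length n v"
  moreover have "l * l = 1"
    by (simp add: l_def flip: power_mult_distrib)
  moreover have "Y v * ?D = l * ?S v"
    using fermionic_factor_nonzero by (simp add: Y_def l_def)
  ultimately show ?thesis
    unfolding l_def[symmetric] by algebra
qed

section \<open>From coefficient functions back to operators\<close>

lemma scaled_hecke_word:
  "foldr (\<lambda>i f. const thalf * hecke i f) is f = const (thalf ^ length is) * foldr hecke is f"
  by (induction "is") (simp_all add: hecke_const_mult const_mult mult.assoc)

text \<open>This justifies the formal calculus: sending a coefficient function to its operator
  intertwines \<open>formal_hecke i\<close> with multiplication by t^(1/2) T_i.\<close>

lemma formal_hecke_word_apply:
  assumes "set is \<subseteq> {1..<n}"
  shows "foldr (\<lambda>i f. const thalf * hecke i f) is f =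
    (\<Sum>v | v permutes {1..n}. foldr formal_hecke is formal_one v * perm_act v f)"
  using assms
proof (induction "is")
  case Nil
  have "(\<Sum>v | v permutes {1..n}. formal_one v * perm_act v f) =
      (\<Sum>v\<in>{id}. formal_one v * perm_act v f)"
    by (rule sum.mono_neutral_right) (auto simp: finite_permutations permutes_id formal_one_def)
  then show ?case by (simp add: formal_one_def)
next
  case (Cons i "is")
  let ?P = "{v. v permutes {1..n}}" and ?s = "\<lambda>v. simple_refl i \<circ> v"
  define F where "F = foldr formal_hecke is formal_one"
  have i: "i \<in> {1..<n}" using Cons by auto
  have IH: "foldr (\<lambda>i f. const thalf * hecke i f) is f = (\<Sum>v\<in>?P. F v * perm_act v f)"
    using Cons by (simp add: F_def)
  have bij: "bij_betw ?s ?P ?P"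
    by (rule bij_betwI[where g = ?s]) (use simple_refl_comp_permutes[OF i] in \<open>auto simp del: o_apply\<close>)
  \<comment> \<open>Moving s_i past a coefficient reflects the coefficient and replaces v by s_i v;
    reindexing by this bijection restores the form of the sum.\<close>
  have "perm_act (simple_refl i) (\<Sum>v\<in>?P. F v * perm_act v f) =
      (\<Sum>v\<in>?P. perm_act (simple_refl i) (F (?s (?s v))) * perm_act (?s v) f)"
    unfolding refl.homs
    by (intro sum.cong refl) (simp add: perm_act_comp permutes_bij del: o_apply)
  also have "\<dots> = (\<Sum>v\<in>?P. perm_act (simple_refl i) (F (?s v)) * perm_act v f)"
    by (rule sum.reindex_bij_betw[OF bij])
  finally have "const thalf * hecke i (\<Sum>v\<in>?P. F v * perm_act v f) =
      (\<Sum>v\<in>?P. formal_hecke i F v * perm_act v f)"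
    unfolding thalf_hecke
    by (simp add: formal_hecke_def sum_distrib_left sum.distrib distrib_right mult.assoc del: o_apply)
  then show ?case using IH by (simp add: F_def)
qed

lemma formal_hecke_perm_apply:
  assumes w: "w permutes {1..n}"
  shows "const (thalf ^ perm_length n w) * hecke_perm n w f =
    (\<Sum>v | v permutes {1..n}. formal_hecke_perm n w v * perm_act v f)"
proof -
  define ws where "ws = (SOME is. reduced_word n w is)"
  have "reduced_word n w ws"
    unfolding ws_def by (rule some_reduced_word[OF w])
  then have "set ws \<subseteq> {1..<n}" "length ws = perm_length n w"
    by (auto simp: reduced_word_def)
  then show ?thesis
    using scaled_hecke_word[of ws f] formal_hecke_word_apply[of ws n f]
    by (simp add: hecke_perm_def formal_hecke_perm_def flip: ws_def)
qed

lemma formal_symmetrizer_apply: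
  "(\<Sum>w | w permutes {1..n}. const (\<beta> ^ perm_length n w * thalf ^ perm_length n w) * hecke_perm n w f) =
   (\<Sum>v | v permutes {1..n}. formal_symmetrizer n \<beta> v * perm_act v f)"
proof -
  have "(\<Sum>w | w permutes {1..n}. const (\<beta> ^ perm_length n w * thalf ^ perm_length n w) * hecke_perm n w f) =
      (\<Sum>w | w permutes {1..n}. \<Sum>v | v permutes {1..n}.
        const (\<beta> ^ perm_length n w) * formal_hecke_perm n w v * perm_act v f)"
    by (rule sum.cong)
      (simp_all add: const_mult mult.assoc formal_hecke_perm_apply sum_distrib_left)
  also have "\<dots> = (\<Sum>v | v permutes {1..n}. formal_symmetrizer n \<beta> v * perm_act v f)"
    unfolding formal_symmetrizer_def sum_distrib_right by (rule sum.swap)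
  finally show ?thesis .
qed

lemma power_int_diff_nat:
  fixes a :: "'a::field"
  assumes "a \<noteq> 0"
  shows "a powi (int k - int m) = a ^ k / a ^ m"
  using assms by (simp add: power_int_diff)

theorem bosonic_sum_eq_symmetrizer:
  "bosonic_sum n E \<nu> =
    const (thalf ^ perm_length n (longest n)) * bosonic_symmetrizer n (E \<nu>)"
proof -
  let ?N = "perm_length n (longest n)"
  have "const (thalf ^ ?N) * bosonic_symmetrizer n (E \<nu>) =
      (\<Sum>w | w permutes {1..n}. const (1 ^ perm_length n w * thalf ^ perm_length n w) * hecke_perm n w (E \<nu>))"
    unfolding bosonic_symmetrizer_def sum_distrib_left
    by (simp add: power_int_diff_nat flip: const_mult mult.assoc)
  also have "\<dots> = (\<Sum>v | v permutes {1..n}. formal_symmetrizer n 1 v * perm_act v (E \<nu>))"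
    by (rule formal_symmetrizer_apply)
  also have "\<dots> = bosonic_sum n E \<nu>"
    unfolding bosonic_sum_def
    by (rule sum.cong)
      (auto simp: formal_symmetrizer_bosonic ratfun_hom.mult[OF perm_act_hom[OF permutes_bij]] mult.commute)
  finally show ?thesis by simp
qed

theorem fermionic_macdonald_eq_symmetrizer:
  "fermionic_macdonald n E \<nu> =
    const (thalf ^ perm_length n (longest n)) * fermionic_symmetrizer n (E \<nu>)"
proof -
  let ?N = "card (index_pairs n)" and ?\<beta> = "- inverse t_par"
  \<comment> \<open>Removing the exponent shift by N leaves the summand for \<beta> = -1/t times
    (-t)^N, the constant in \<open>formal_symmetrizer_fermionic\<close>.\<close>
  have coeff: "thalf ^ ?N * (- inverse thalf) powi (int k - int ?N) =
      (- t_par) ^ ?N * (?\<beta> ^ k * thalf ^ k)" for k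
  proof -
    have "(- inverse thalf) powi (int k - int ?N) = (- inverse thalf) ^ k * (- thalf) ^ ?N"
      by (simp add: power_int_diff_nat power_inverse[symmetric] divide_inverse flip: inverse_minus_eq)
    moreover have "?\<beta> ^ k * thalf ^ k = (- inverse thalf) ^ k"
      unfolding power_mult_distrib[symmetric] by (simp add: t_par_def power2_eq_square mult.assoc)
    moreover have "thalf ^ ?N * (- thalf) ^ ?N = (- t_par) ^ ?N"
      unfolding power_mult_distrib[symmetric] by (simp add: t_par_def power2_eq_square)
    ultimately show ?thesis by (simp add: mult.left_commute mult.commute)
  qed
  have "const (thalf ^ perm_length n (longest n)) * fermionic_symmetrizer n (E \<nu>) =
      const ((- t_par) ^ ?N) *
      (\<Sum>w | w permutes {1..n}. const (?\<beta> ^ perm_length n w * thalf ^ perm_length n w) * hecke_perm n w (E \<nu>))"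
    unfolding fermionic_symmetrizer_def sum_distrib_left perm_length_longest
    by (simp only: coeff flip: const_mult mult.assoc)
  also have "\<dots> = (\<Sum>v | v permutes {1..n}.
      const ((- t_par) ^ ?N) * formal_symmetrizer n ?\<beta> v * perm_act v (E \<nu>))"
    unfolding formal_symmetrizer_apply sum_distrib_left by (simp only: mult.assoc)
  also have "\<dots> = fermionic_macdonald n E \<nu>"
    unfolding fermionic_macdonald_def fermionic_factor_def[symmetric] sum_distrib_left
    by (rule sum.cong) (auto simp: formal_symmetrizer_fermionic mult.left_commute mult.assoc)
  finally show ?thesis by simp
qed

section \<open>Specialisation at $t^{1/2} = 1$\<close>

text \<open>The local ring at t^(1/2) = 1. Here \<open>poly r 1\<close> evaluates the outer variable
  t^(1/2) only and is a polynomial in q, so denominators such as q or 1 - q^m are allowed.\<close>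

definition regular :: "coeff_field set"
  where "regular = {Fraction_Field.Fract p r | p r. poly r 1 \<noteq> 0}"

lemma regularI: "poly r 1 \<noteq> 0 \<Longrightarrow> Fraction_Field.Fract p r \<in> regular"
  by (auto simp: regular_def)

lemma regularE:
  assumes "c \<in> regular"
  obtains p r where "c = Fraction_Field.Fract p r" "poly r 1 \<noteq> 0" "r \<noteq> 0"
  using assms by (force simp: regular_def)

lemma regular_0 [simp]: "0 \<in> regular" and regular_1 [simp]: "1 \<in> regular"
  by (simp_all add: fract_expand regularI)

lemma regular_add: "a \<in> regular \<Longrightarrow> b \<in> regular \<Longrightarrow> a + b \<in> regular"
  by (elim regularE) (simp add: regularI)

lemma regular_mult: "a \<in> regular \<Longrightarrow> b \<in> regular \<Longrightarrow> a * b \<in> regular"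
  by (elim regularE) (simp add: regularI)

lemma regular_uminus: "a \<in> regular \<Longrightarrow> - a \<in> regular"
  by (elim regularE) (simp add: regularI)

lemma regular_diff: "a \<in> regular \<Longrightarrow> b \<in> regular \<Longrightarrow> a - b \<in> regular"
  using regular_add[of a "- b"] regular_uminus by simp

lemma regular_power: "a \<in> regular \<Longrightarrow> a ^ k \<in> regular"
  by (induction k) (simp_all add: regular_mult)

lemma regular_sum: "(\<And>a. a \<in> A \<Longrightarrow> f a \<in> regular) \<Longrightarrow> sum f A \<in> regular"
  by (induction A rule: infinite_finite_induct) (simp_all add: regular_add)

lemma regular_parameters:
  "thalf \<in> regular" "inverse thalf \<in> regular" "q_par \<in> regular" "inverse q_par \<in> regular"
  "t_par \<in> regular" "inverse t_par \<in> regular"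
proof -
  show *: "thalf \<in> regular" "inverse thalf \<in> regular" "q_par \<in> regular" "inverse q_par \<in> regular"
    by (simp_all add: thalf_def q_par_def regularI)
  show "t_par \<in> regular" "inverse t_par \<in> regular"
    unfolding t_par_def power_inverse[symmetric] by (intro regular_power *)+
qed

lemma regular_powi: "a \<in> regular \<Longrightarrow> inverse a \<in> regular \<Longrightarrow> a powi k \<in> regular"
  by (simp add: power_int_def regular_power)

lemma q_par_nonzero [simp]: "q_par \<noteq> 0"
  by (simp add: q_par_def Zero_fract_def eq_fract)

lemma q_par_power: "q_par ^ m = Fraction_Field.Fract ([:[:0, 1:]:] ^ m) 1"
  by (induction m) (simp_all add: q_par_def fract_expand)

lemma t_par_power: "t_par ^ m = Fraction_Field.Fract ([:0, 1:] ^ (2 * m)) 1"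
proof -
  have "thalf ^ k = Fraction_Field.Fract ([:0, 1:] ^ k) 1" for k
    by (induction k) (simp_all add: thalf_def fract_expand)
  then show ?thesis unfolding t_par_def power_mult[symmetric] .
qed

lemma one_minus_q_power_nonzero:
  assumes "0 < m"
  shows "1 - [:0, 1:] ^ m \<noteq> (0 :: complex poly)"
proof
  assume "1 - [:0, 1:] ^ m = (0 :: complex poly)"
  then have "poly (1 - [:0, 1:] ^ m) (0::complex) = 0" by simp
  then show False using assms by (simp add: power_0_left)
qed

text \<open>At $t = 1$ the denominator becomes $1 - q^m$ with $m > 0$, which does not vanish.\<close>

lemma regular_exchange_denominator:
  assumes m: "0 < m"
  shows "inverse (1 - q_par powi m * t_par powi k) \<in> regular"
proof -
  obtain l where l: "m = int l" "0 < l" using m by (metis zero_less_imp_eq_int)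
  let ?Q = "[:[:0, 1:]:] :: complex poly poly" and ?T = "[:0, 1:] :: complex poly poly"
  have Q: "poly (?Q ^ l) 1 = [:0, 1:] ^ l" by simp
  show ?thesis
  proof (cases k rule: int_cases2)
    case j: (nonneg j)
    have "inverse (1 - q_par powi m * t_par powi k) = Fraction_Field.Fract 1 (1 - ?Q ^ l * ?T ^ (2 * j))"
      unfolding l(1) j power_int_of_nat q_par_power t_par_power by (simp add: fract_expand)
    then show ?thesis
      using one_minus_q_power_nonzero[OF l(2)] by (auto intro!: regularI)
  next
    case j: (nonpos j)
    have T: "?T ^ (2 * j) \<noteq> 0" by simp
    \<comment> \<open>A negative power of t is cleared first; at t^(1/2) = 1 the numerator is again
      1 - q^l.\<close>
    have "1 - q_par powi m * t_par powi k = Fraction_Field.Fract (?T ^ (2 * j) - ?Q ^ l) (?T ^ (2 * j))"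
      unfolding l(1) j power_int_of_nat power_int_minus q_par_power t_par_power
      using T by (simp add: fract_expand(2) del: pCons_0_0 power_eq_0_iff)
    then have "inverse (1 - q_par powi m * t_par powi k) = Fraction_Field.Fract (?T ^ (2 * j)) (?T ^ (2 * j) - ?Q ^ l)"
      by simp
    then show ?thesis
      using one_minus_q_power_nonzero[OF l(2)] by (auto intro!: regularI)
  qed
qed

text \<open>The residue at t^(1/2) = 1 is k, which is nonzero in characteristic 0.\<close>

lemma of_nat_plus_regular_nonzero:
  assumes k: "0 < k" and c: "c \<in> regular"
  shows "of_nat k + (thalf - 1) * c \<noteq> 0"
proof
  assume eq: "of_nat k + (thalf - 1) * c = 0"
  obtain p r where pr: "c = Fraction_Field.Fract p r" "poly r 1 \<noteq> 0" "r \<noteq> 0"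
    using c by (rule regularE)
  have "Fraction_Field.Fract (of_nat k * r + ([:0, 1:] - 1) * p) r = 0"
    using eq pr(3) by (simp add: pr(1) thalf_def of_nat_fract One_fract_def)
  then have "of_nat k * r + ([:0, 1:] - 1) * p = 0"
    using pr(3) by (simp add: Zero_fract_def eq_fract)
  then have "poly (of_nat k * r + ([:0, 1:] - 1) * p) 1 = 0" by simp
  then have "of_nat k * poly r 1 = 0" by simp
  then show False using k pr(2) by simp
qed

text \<open>Laurent polynomials over the local ring, given by generators so that stability under an
  operator can be checked by induction on them.\<close>

inductive_set regular_laurents :: "nat \<Rightarrow> ratfun set" for n
  where
    const: "c \<in> regular \<Longrightarrow> const c \<in> regular_laurents n"
  | X: "i \<in> {1..n} \<Longrightarrow> X i \<in> regular_laurents n"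
  | inverse_X: "i \<in> {1..n} \<Longrightarrow> inverse (X i) \<in> regular_laurents n"
  | add: "x \<in> regular_laurents n \<Longrightarrow> y \<in> regular_laurents n \<Longrightarrow> x + y \<in> regular_laurents n"
  | mult: "x \<in> regular_laurents n \<Longrightarrow> y \<in> regular_laurents n \<Longrightarrow> x * y \<in> regular_laurents n"

lemma regular_laurents_0 [simp]: "0 \<in> regular_laurents n"
  and regular_laurents_1 [simp]: "1 \<in> regular_laurents n"
  using regular_laurents.const[of 0 n] regular_laurents.const[of 1 n] by simp_all

lemma regular_laurents_uminus:
  assumes "x \<in> regular_laurents n"
  shows "- x \<in> regular_laurents n"
proof -
  have "const (- 1) * x \<in> regular_laurents n"
    using assms by (intro regular_laurents.mult regular_laurents.const regular_uminus regular_1)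
  then show ?thesis by (simp add: const_uminus)
qed

lemma regular_laurents_diff:
  "x \<in> regular_laurents n \<Longrightarrow> y \<in> regular_laurents n \<Longrightarrow> x - y \<in> regular_laurents n"
  using regular_laurents.add[of x n "- y"] regular_laurents_uminus by simp

lemma regular_laurents_prod:
  "(\<And>a. a \<in> A \<Longrightarrow> f a \<in> regular_laurents n) \<Longrightarrow> prod f A \<in> regular_laurents n"
  by (induction A rule: infinite_finite_induct) (simp_all add: regular_laurents.mult)

lemma regular_laurents_sum:
  "(\<And>a. a \<in> A \<Longrightarrow> f a \<in> regular_laurents n) \<Longrightarrow> sum f A \<in> regular_laurents n"
  by (induction A rule: infinite_finite_induct) (simp_all add: regular_laurents.add)

lemma regular_laurents_power: "x \<in> regular_laurents n \<Longrightarrow> x ^ k \<in> regular_laurents n"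
  by (induction k) (simp_all add: regular_laurents.mult)

lemma regular_laurents_powi:
  "x \<in> regular_laurents n \<Longrightarrow> inverse x \<in> regular_laurents n \<Longrightarrow> x powi k \<in> regular_laurents n"
  by (simp add: power_int_def regular_laurents_power)

lemmas regular_laurents_intros = regular_laurents.intros regular_laurents_uminus regular_laurents_diff

lemma regular_laurents_perm_act:
  assumes z: "z \<in> regular_laurents n" and w: "w permutes {1..n}"
  shows "perm_act w z \<in> regular_laurents n"
  using z
proof induction
  interpret w: ratfun_hom "perm_act w" by (rule perm_act_hom[OF permutes_bij[OF w]])
  have mem: "w i \<in> {1..n}" if "i \<in> {1..n}" for i using that w by (simp only: permutes_in_image)
  {
    case (const c)
    then show ?case by (simp add: w.const regular_laurents.const)
  next
    case (X i)
    then show ?case using mem by (simp add: perm_act_X regular_laurents.X)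
  next
    case (inverse_X i)
    then show ?case using mem by (simp add: w.inverse perm_act_X regular_laurents.inverse_X)
  next
    case (add x y)
    then show ?case by (simp add: w.add regular_laurents.add)
  next
    case (mult x y)
    then show ?case by (simp add: w.mult regular_laurents.mult)
  }
qed

text \<open>The Leibniz rule $\partial_i(fg) = \partial_i(f)\,g + s_i(f)\,\partial_i(g)$ reduces the claim to the generators.\<close>

lemma regular_laurents_divided_diff:
  assumes z: "z \<in> regular_laurents n" and i: "i \<in> {1..<n}"
  shows "divided_diff i z \<in> regular_laurents n"
  using z
proof induction
  have i': "i \<in> {1..n}" "Suc i \<in> {1..n}" using i by auto
  have nz: "X i - X (Suc i) \<noteq> 0" by simp
  {
    case (const c)
    then show ?case by (simp add: divided_diff_def refl.const)
  next
    case (X j)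
    have "divided_diff i (X j) = (if j = i then 1 else if j = Suc i then - 1 else 0)"
      using nz by (simp add: divided_diff_def simple_refl_apply divide_eq_eq)
    then show ?case by (simp add: regular_laurents_uminus)
  next
    case (inverse_X j)
    have "divided_diff i (inverse (X j)) =
        (if j = i then - (inverse (X i) * inverse (X (Suc i)))
         else if j = Suc i then inverse (X i) * inverse (X (Suc i)) else 0)"
      using nz by (simp add: divided_diff_def simple_refl_apply refl.inverse divide_eq_eq) (simp add: field_simps)
    then show ?case using i' by (simp add: regular_laurents_intros del: inverse_mult_distrib)
  next
    case (add x y)
    have "divided_diff i (x + y) = divided_diff i x + divided_diff i y"
      by (simp add: divided_diff_def refl.add diff_divide_distrib add_divide_distrib)
    then show ?case using add by (simp add: regular_laurents.add)
  next
    case (mult x y)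
    have "divided_diff i (x * y) = divided_diff i x * y + perm_act (simple_refl i) x * divided_diff i y"
      using nz by (simp add: divided_diff_def refl.mult divide_simps) (simp add: algebra_simps)
    then show ?case
      using mult regular_laurents_perm_act simple_refl_permutes[OF i]
      by (simp add: regular_laurents.add regular_laurents.mult)
  }
qed

text \<open>Passes from generators back to coefficients, so that a congruence between Laurent
  polynomials can be read off at a single monomial.\<close>

lemma regular_laurents_lookup:
  assumes "z \<in> regular_laurents n"
  shows "\<exists>f. z = of_laurent f \<and> (\<forall>m\<in>Poly_Mapping.keys f. Poly_Mapping.keys m \<subseteq> {1..n}) \<and>
    (\<forall>m. Poly_Mapping.lookup f m \<in> regular)"
  using assms
proof induction
  case (const c)
  then show ?case
    by (intro exI[of _ "Poly_Mapping.single 0 c"]) (auto simp: const_def lookup_single when_def)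
next
  case (X i)
  then show ?case
    by (intro exI[of _ "Poly_Mapping.single (Poly_Mapping.single i 1) 1"]) (auto simp: X_def lookup_single when_def)
next
  case (inverse_X i)
  have "inverse (X i) = of_laurent (Poly_Mapping.single (Poly_Mapping.single i (- 1)) 1)"
    using X_powi[of i "- 1"] by (simp add: power_int_minus)
  then show ?case using inverse_X
    by (intro exI[of _ "Poly_Mapping.single (Poly_Mapping.single i (- 1)) 1"]) (auto simp: lookup_single when_def)
next
  case (add x y)
  then obtain f g where f: "x = of_laurent f" "\<forall>m\<in>Poly_Mapping.keys f. Poly_Mapping.keys m \<subseteq> {1..n}"
      "\<forall>m. Poly_Mapping.lookup f m \<in> regular"
    and g: "y = of_laurent g" "\<forall>m\<in>Poly_Mapping.keys g. Poly_Mapping.keys m \<subseteq> {1..n}"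
      "\<forall>m. Poly_Mapping.lookup g m \<in> regular" by blast
  show ?case
  proof (intro exI conjI ballI allI)
    show "x + y = of_laurent (f + g)" by (simp add: f g of_laurent_add)
    show "Poly_Mapping.keys m \<subseteq> {1..n}" if "m \<in> Poly_Mapping.keys (f + g)" for m
      using that Poly_Mapping.keys_add[of f g] f g by blast
    show "Poly_Mapping.lookup (f + g) m \<in> regular" for m
      using f g by (simp add: lookup_add regular_add)
  qed
next
  case (mult x y)
  then obtain f g where f: "x = of_laurent f" "\<forall>m\<in>Poly_Mapping.keys f. Poly_Mapping.keys m \<subseteq> {1..n}"
      "\<forall>m. Poly_Mapping.lookup f m \<in> regular"
    and g: "y = of_laurent g" "\<forall>m\<in>Poly_Mapping.keys g. Poly_Mapping.keys m \<subseteq> {1..n}"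
      "\<forall>m. Poly_Mapping.lookup g m \<in> regular" by blast
  show ?case
  proof (intro exI conjI ballI allI)
    show "x * y = of_laurent (f * g)" by (simp add: f g of_laurent_mult)
    show "Poly_Mapping.keys m \<subseteq> {1..n}" if m: "m \<in> Poly_Mapping.keys (f * g)" for m
    proof -
      obtain a b where "m = a + b" "a \<in> Poly_Mapping.keys f" "b \<in> Poly_Mapping.keys g"
        using m Poly_Mapping.keys_mult[of f g] by blast
      then show ?thesis using Poly_Mapping.keys_add[of a b] f g by blast
    qed
    have "Poly_Mapping.lookup (f * g) m \<in> regular" for m
    proof -
      have "f * g = (\<Sum>a\<in>Poly_Mapping.keys f. \<Sum>b\<in>Poly_Mapping.keys g.
          Poly_Mapping.single a (Poly_Mapping.lookup f a) * Poly_Mapping.single b (Poly_Mapping.lookup g b))"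
        by (simp only: sum_product[symmetric] poly_mapping_sum_singles[symmetric])
      then show ?thesis
        using f g by (simp add: lookup_sum mult_single lookup_single when_def regular_sum regular_mult)
    qed
    then show "Poly_Mapping.lookup (f * g) m \<in> regular" for m .
  qed
qed

text \<open>Stands in for equality of the specialisations at t^(1/2) = 1, without defining a
  specialisation map.\<close>

definition thalf_cong :: "nat \<Rightarrow> ratfun \<Rightarrow> ratfun \<Rightarrow> bool"
  where "thalf_cong n z z' \<longleftrightarrow> (\<exists>u\<in>regular_laurents n. z = z' + const (thalf - 1) * u)"

lemma thalf_congI: "u \<in> regular_laurents n \<Longrightarrow> z = z' + const (thalf - 1) * u \<Longrightarrow> thalf_cong n z z'"
  unfolding thalf_cong_def by blast

lemma thalf_cong_refl: "thalf_cong n z z"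
  by (rule thalf_congI[of 0]) simp_all

lemma thalf_cong_trans:
  assumes "thalf_cong n x y" "thalf_cong n y z"
  shows "thalf_cong n x z"
proof -
  obtain u v where "u \<in> regular_laurents n" "x = y + const (thalf - 1) * u"
    "v \<in> regular_laurents n" "y = z + const (thalf - 1) * v"
    using assms unfolding thalf_cong_def by blast
  then show ?thesis
    by (intro thalf_congI[of "u + v"]) (simp_all add: regular_laurents.add distrib_left)
qed

lemma thalf_cong_sum:
  "(\<And>a. a \<in> A \<Longrightarrow> thalf_cong n (f a) (g a)) \<Longrightarrow> thalf_cong n (sum f A) (sum g A)"
proof (induction A rule: infinite_finite_induct)
  case (insert a A)
  then obtain u v where "u \<in> regular_laurents n" "f a = g a + const (thalf - 1) * u"
    "v \<in> regular_laurents n" "sum f A = sum g A + const (thalf - 1) * v"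
    unfolding thalf_cong_def by (metis insertCI)
  then show ?case using insert(1,2)
    by (intro thalf_congI[of "u + v"]) (simp_all add: regular_laurents.add distrib_left)
qed (simp_all add: thalf_cong_refl)

lemma thalf_cong_mult:
  assumes "thalf_cong n x y" "a \<in> regular_laurents n"
  shows "thalf_cong n (a * x) (a * y)"
proof -
  obtain u where "u \<in> regular_laurents n" "x = y + const (thalf - 1) * u"
    using assms unfolding thalf_cong_def by blast
  then show ?thesis
    using assms by (intro thalf_congI[of "a * u"]) (simp_all add: regular_laurents.mult distrib_left mult.left_commute)
qed

lemma thalf_cong_perm_act:
  assumes "thalf_cong n x y" "w permutes {1..n}"
  shows "thalf_cong n (perm_act w x) (perm_act w y)"
proof -
  interpret w: ratfun_hom "perm_act w" by (rule perm_act_hom[OF permutes_bij[OF assms(2)]])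
  obtain u where "u \<in> regular_laurents n" "x = y + const (thalf - 1) * u"
    using assms unfolding thalf_cong_def by blast
  then show ?thesis
    using assms by (intro thalf_congI[of "perm_act w u"]) (simp_all add: regular_laurents_perm_act w.homs)
qed

text \<open>Regularity of E_\<mu> is thereby a by-product of its congruence to a monomial and is not
  tracked separately.\<close>

lemma thalf_cong_regular:
  "thalf_cong n x y \<Longrightarrow> y \<in> regular_laurents n \<Longrightarrow> x \<in> regular_laurents n"
  by (auto simp: thalf_cong_def regular_parameters intro!: regular_laurents.add regular_laurents.mult
      regular_laurents.const regular_diff)

lemma thalf_cong_hecke:
  assumes i: "i \<in> {1..<n}" and cong: "thalf_cong n f g" and g: "g \<in> regular_laurents n"
  shows "thalf_cong n (const thalf * hecke i f) (perm_act (simple_refl i) g)"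
proof (rule thalf_cong_trans)
  let ?s = "perm_act (simple_refl i)"
  have f: "f \<in> regular_laurents n" using cong g by (rule thalf_cong_regular)
  have nz: "X i - X (Suc i) \<noteq> 0" by simp
  \<comment> \<open>In this form the denominator is absorbed in the divided difference, which
    preserves \<open>regular_laurents\<close>, and the correction to s_i carries a factor 1 -
    t.\<close>
  have "const thalf * hecke i f = const t_par * ?s f + (1 - const t_par) * X (Suc i) * divided_diff i f"
    unfolding thalf_hecke hecke_diag_def hecke_offdiag_def divided_diff_def
    using nz by (simp add: divide_simps) algebra
  moreover have "const t_par = 1 + const (thalf - 1) * const (thalf + 1)"
    by (simp add: t_par_def power2_eq_square const_add const_diff const_mult algebra_simps)
  ultimately have "const thalf * hecke i f =
      ?s f + const (thalf - 1) * (const (thalf + 1) * (?s f - X (Suc i) * divided_diff i f))"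
    by algebra
  then show "thalf_cong n (const thalf * hecke i f) (?s f)"
    by (rule thalf_congI[rotated])
      (use i f in \<open>auto intro!: regular_laurents_intros regular_laurents_perm_act regular_laurents_divided_diff
        simple_refl_permutes simp: regular_add regular_parameters\<close>)
  show "thalf_cong n (?s f) (?s g)"
    using cong simple_refl_permutes[OF i] by (rule thalf_cong_perm_act)
qed

lemma thalf_cong_hecke_word:
  assumes "set is \<subseteq> {1..<n}" "thalf_cong n f g" "g \<in> regular_laurents n"
  shows "thalf_cong n (foldr (\<lambda>i f. const thalf * hecke i f) is f) (perm_act (word_perm is) g)"
  using assms(1)
proof (induction "is")
  case Nil
  have "perm_act (word_perm []) g = g" by (metis perm_act_id word_perm_simps(1))
  then show ?case using assms(2) by (simp only: foldr.simps id_apply)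
next
  case (Cons i "is")
  then have i: "i \<in> {1..<n}" and w: "word_perm is permutes {1..n}"
    using word_perm_permutes by auto
  have eq: "perm_act (word_perm (i # is)) g = perm_act (simple_refl i) (perm_act (word_perm is) g)"
    using perm_act_comp[OF bij_simple_refl permutes_bij[OF w]] by (metis word_perm_simps(2))
  show ?case
    unfolding foldr.simps o_apply eq
    by (rule thalf_cong_hecke[OF i Cons.IH regular_laurents_perm_act[OF assms(3) w]]) (use Cons.prems in simp)
qed

section \<open>Electronic Macdonald polynomials at $t^{1/2} = 1$\<close>

definition weight_monomial :: "nat \<Rightarrow> (nat \<Rightarrow> int) \<Rightarrow> ratfun"
  where "weight_monomial n \<mu> = (\<Prod>i\<in>{1..n}. X i powi \<mu> i)"

lemma weight_monomial_regular [simp]: "weight_monomial n \<mu> \<in> regular_laurents n"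
  unfolding weight_monomial_def
  by (intro regular_laurents_prod regular_laurents_powi regular_laurents.X regular_laurents.inverse_X)

lemma lookup_weight:
  assumes "\<mu> \<in> weights n"
  shows "Poly_Mapping.lookup (Abs_poly_mapping \<mu>) = \<mu>"
    and "Poly_Mapping.keys (Abs_poly_mapping \<mu>) \<subseteq> {1..n}"
proof -
  have "finite {i. \<mu> i \<noteq> 0}"
    by (rule finite_subset[of _ "{1..n}"]) (use assms in \<open>auto simp: weights_def\<close>)
  then show eq: "Poly_Mapping.lookup (Abs_poly_mapping \<mu>) = \<mu>" by simp
  then show "Poly_Mapping.keys (Abs_poly_mapping \<mu>) \<subseteq> {1..n}"
    using assms by (auto simp: in_keys_iff weights_def)
qed

lemma weight_monomial_of_laurent:
  assumes "\<mu> \<in> weights n"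
  shows "weight_monomial n \<mu> = of_laurent (Poly_Mapping.single (Abs_poly_mapping \<mu>) 1)"
  using monomial_eval_superset[of "{1..n}" "Abs_poly_mapping \<mu>" X] lookup_weight[OF assms]
  by (simp add: weight_monomial_def monomial_eval_X)

lemma weight_act_weights:
  assumes "w permutes {1..n}" "\<mu> \<in> weights n"
  shows "weight_act w \<mu> \<in> weights n"
  using assms permutes_not_in[OF permutes_inv[OF assms(1)]] by (simp add: weights_def weight_act_def)

lemma perm_act_weight_monomial:
  assumes w: "w permutes {1..n}"
  shows "perm_act w (weight_monomial n \<mu>) = weight_monomial n (weight_act w \<mu>)"
proof -
  interpret w: ratfun_hom "perm_act w" by (rule perm_act_hom[OF permutes_bij[OF w]])
  have "perm_act w (weight_monomial n \<mu>) = (\<Prod>i\<in>{1..n}. (\<lambda>j. X j powi \<mu> (inv w j)) (w i))"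
    using w by (simp add: weight_monomial_def w.homs perm_act_X permutes_inverses)
  also have "\<dots> = weight_monomial n (weight_act w \<mu>)"
    unfolding weight_monomial_def weight_act_def
    using prod.reindex_bij_betw[OF permutes_imp_bij[OF w]] by simp
  finally show ?thesis .
qed

definition rotate_point :: "nat \<Rightarrow> nat \<Rightarrow> ratfun"
  where "rotate_point n i = (if i < n then X (Suc i) else if i = n then const (inverse q_par) * X 1 else X i)"

text \<open>For \<open>n > 0\<close> this substitution has a kernel, since $x_0$ (which is not among the $n$ variables) goes
  to $x_1$ as well; hence \<open>rotate_vars n\<close> is only multiplicative on Laurent polynomials.\<close>

lemma rotate_vars_of_laurent: "rotate_vars n (of_laurent f) = laurent_eval (rotate_point n) f"
  unfolding rotate_vars_def rotate_point_def[abs_def] by (rule subst_vars_of_laurent) auto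

text \<open>The Laurent representative is carried through the induction because sums and products
  can be rotated only via \<open>laurent_eval\<close>.\<close>

lemma regular_laurents_rotate:
  assumes "1 \<le> n" "z \<in> regular_laurents n"
  shows "\<exists>f. z = of_laurent f \<and> rotate_vars n z \<in> regular_laurents n"
  using assms(2)
proof induction
  let ?g = "rotate_point n"
  have g: "?g i \<noteq> 0" for i by (simp add: rotate_point_def)
  {
    case (const c)
    then show ?case
      by (metis const_def rotate_vars_of_laurent laurent_eval_const regular_laurents.const)
  next
    case (X i)
    have "rotate_vars n (X i) = ?g i"
      unfolding X_def[of i] rotate_vars_of_laurent laurent_eval_single by (simp add: monomial_eval_def)
    moreover have "?g i \<in> regular_laurents n"
      using X assms(1) by (auto simp: rotate_point_def regular_parameters intro!: regular_laurents_intros)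
    ultimately show ?case by (metis X_def)
  next
    case (inverse_X i)
    have eq: "inverse (X i) = of_laurent (Poly_Mapping.single (Poly_Mapping.single i (- 1)) 1)"
      using X_powi[of i "- 1"] by (simp add: power_int_minus)
    have "rotate_vars n (inverse (X i)) = inverse (?g i)"
      unfolding eq rotate_vars_of_laurent laurent_eval_single by (simp add: monomial_eval_def power_int_minus)
    moreover have "inverse (?g i) \<in> regular_laurents n"
      using inverse_X assms(1)
      by (auto simp: rotate_point_def regular_parameters const_inverse[symmetric] intro!: regular_laurents_intros)
    ultimately show ?case using eq by metis
  next
    case (add x y)
    then show ?case
      by (metis of_laurent_add rotate_vars_of_laurent laurent_eval_add regular_laurents.add)
  next
    case (mult x y)
    then show ?case
      by (metis of_laurent_mult rotate_vars_of_laurent laurent_eval_mult[of ?g, OF g] regular_laurents.mult)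
  }
qed

lemma thalf_cong_rotate:
  assumes n: "1 \<le> n" and cong: "thalf_cong n x y" and y: "y \<in> regular_laurents n"
  shows "thalf_cong n (rotate_vars n x) (rotate_vars n y)"
proof -
  let ?g = "rotate_point n"
  have g: "?g i \<noteq> 0" for i by (simp add: rotate_point_def)
  obtain u where u: "u \<in> regular_laurents n" "x = y + const (thalf - 1) * u"
    using cong unfolding thalf_cong_def by blast
  obtain f h where f: "y = of_laurent f" and h: "u = of_laurent h" "rotate_vars n u \<in> regular_laurents n"
    using regular_laurents_rotate[OF n] y u(1) by metis
  have "x = of_laurent (f + Poly_Mapping.single 0 (thalf - 1) * h)"
    by (simp add: u(2) f h(1) of_laurent_add of_laurent_mult const_def)
  then have "rotate_vars n x = rotate_vars n y + const (thalf - 1) * rotate_vars n u"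
    by (simp add: f h(1) rotate_vars_of_laurent laurent_eval_add laurent_eval_mult g laurent_eval_const)
  then show ?thesis using h(2) by (rule thalf_congI[rotated])
qed

text \<open>The factor q^(\<mu>_n) cancels the power of q produced by substituting x_1/q for x_n, so
  monomials go to monomials exactly, even before specialising.\<close>

lemma rotate_weight_monomial:
  assumes n: "1 \<le> n" and \<mu>: "\<mu> \<in> weights n"
  shows "const (q_par powi \<mu> n) * X 1 * rotate_vars n (weight_monomial n \<mu>) =
    weight_monomial n (rotate_weight n \<mu>)"
proof -
  have "rotate_vars n (weight_monomial n \<mu>) = (\<Prod>i\<in>{1..n}. rotate_point n i powi \<mu> i)"
    using monomial_eval_superset[of "{1..n}" "Abs_poly_mapping \<mu>" "rotate_point n"] lookup_weight[OF \<mu>]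
    by (simp add: weight_monomial_of_laurent[OF \<mu>] rotate_vars_of_laurent laurent_eval_single)
  also have "{1..n} = insert n {1..<n}" using n by auto
  also have "(\<Prod>i\<in>insert n {1..<n}. rotate_point n i powi \<mu> i) =
      (const (inverse q_par) * X 1) powi \<mu> n * (\<Prod>i\<in>{1..<n}. X (Suc i) powi \<mu> i)"
    by (simp add: rotate_point_def)
  finally have "const (q_par powi \<mu> n) * X 1 * rotate_vars n (weight_monomial n \<mu>) =
      X 1 * X 1 powi \<mu> n * (\<Prod>i\<in>{1..<n}. X (Suc i) powi \<mu> i)"
    by (simp add: power_int_mult_distrib const_inverse power_int_inverse const_power_int)
  also have "X 1 * X 1 powi \<mu> n = X 1 powi (\<mu> n + 1)"
    by (simp add: power_int_add)
  also have "(\<Prod>i\<in>{1..<n}. X (Suc i) powi \<mu> i) = (\<Prod>i\<in>{Suc 1..<Suc n}. X i powi \<mu> (i - 1))"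
    by (subst prod.shift_bounds_Suc_ivl) simp
  also have "X 1 powi (\<mu> n + 1) * (\<Prod>i\<in>{Suc 1..<Suc n}. X i powi \<mu> (i - 1)) =
      (\<Prod>i\<in>insert 1 {Suc 1..<Suc n}. X i powi rotate_weight n \<mu> i)"
    by (subst prod.insert) (auto simp: rotate_weight_def intro!: prod.cong)
  also have "insert 1 {Suc 1..<Suc n} = {1..n}" using n by auto
  finally show ?thesis by (simp add: weight_monomial_def)
qed

text \<open>Since the divided difference of x_i f is s_i f plus x_i times that of f, the recursion
  reads s_i f + (1 - t)(x_i \<open>divided_diff i f\<close> + a/(1 - a) f). The strict inequality
  gives a a positive power of q, which keeps 1/(1 - a) regular.\<close>

lemma thalf_cong_exchange:
  assumes i: "i \<in> {1..<n}" and cong: "thalf_cong n f g" and g: "g \<in> regular_laurents n"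
    and m: "\<mu> (Suc i) < \<mu> i"
  shows "thalf_cong n (divided_diff i (X i * f) - const t_par * X i * divided_diff i f +
      const ((1 - t_par) * exchange_par n \<mu> i / (1 - exchange_par n \<mu> i)) * f)
    (perm_act (simple_refl i) g)"
proof (rule thalf_cong_trans)
  let ?s = "perm_act (simple_refl i)"
  have f: "f \<in> regular_laurents n" using cong g by (rule thalf_cong_regular)
  have nz: "X i - X (Suc i) \<noteq> 0" by simp
  define a where "a = exchange_par n \<mu> i"
  have t: "1 - t_par = (thalf - 1) * (- (thalf + 1))"
    by (simp add: t_par_def power2_eq_square algebra_simps)
  have c: "const ((1 - t_par) * a / (1 - a)) =
      const (thalf - 1) * (const (- (thalf + 1)) * const (a * inverse (1 - a)))"
    unfolding t by (simp only: divide_inverse const_mult[symmetric] mult.assoc)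
  have "divided_diff i (X i * f) - const t_par * X i * divided_diff i f =
      ?s f + const (1 - t_par) * X i * divided_diff i f"
    unfolding divided_diff_def const_diff const_1
    using nz by (simp add: refl.mult simple_refl_apply divide_simps) algebra
  then have eq: "divided_diff i (X i * f) - const t_par * X i * divided_diff i f + const ((1 - t_par) * a / (1 - a)) * f =
      ?s f + const (thalf - 1) * (const (- (thalf + 1)) *
        (X i * divided_diff i f + const (a * inverse (1 - a)) * f))"
    unfolding c unfolding t const_mult by (simp only: ring_distribs ac_simps)
  have a: "a \<in> regular" "inverse (1 - a) \<in> regular"
    using m by (auto simp: a_def exchange_par_def regular_parameters
        intro!: regular_exchange_denominator regular_mult regular_powi)
  have "const (- (thalf + 1)) * (X i * divided_diff i f + const (a * inverse (1 - a)) * f) \<in> regular_laurents n"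
    using i by (intro regular_laurents.mult regular_laurents.add regular_laurents.const regular_laurents.X
        regular_laurents_divided_diff regular_uminus regular_add regular_mult regular_parameters regular_1 a f) auto
  then show "thalf_cong n (divided_diff i (X i * f) - const t_par * X i * divided_diff i f +
      const ((1 - t_par) * exchange_par n \<mu> i / (1 - exchange_par n \<mu> i)) * f) (?s f)"
    using eq unfolding a_def[symmetric] by (rule thalf_congI)
  show "thalf_cong n (?s f) (?s g)"
    using cong simple_refl_permutes[OF i] by (rule thalf_cong_perm_act)
qed

context
  fixes n E
  assumes n: "1 \<le> n" and E: "electronic_macdonald n E"
begin

lemma electronic_zero: "E (\<lambda>_. 0) = 1"
  using E by (simp add: electronic_macdonald_def)

lemma electronic_rotate:
  "\<mu> \<in> weights n \<Longrightarrow> E (rotate_weight n \<mu>) = const (q_par powi \<mu> n) * X 1 * rotate_vars n (E \<mu>)"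
  using E unfolding electronic_macdonald_def by blast

lemma electronic_exchange:
  "\<mu> \<in> weights n \<Longrightarrow> i \<in> {1..<n} \<Longrightarrow> \<forall>j. 0 \<le> \<mu> j \<Longrightarrow> \<mu> (Suc i) < \<mu> i \<Longrightarrow>
    E (weight_act (simple_refl i) \<mu>) =
      divided_diff i (X i * E \<mu>) - const t_par * X i * divided_diff i (E \<mu>) +
      const ((1 - t_par) * exchange_par n \<mu> i / (1 - exchange_par n \<mu> i)) * E \<mu>"
  using E unfolding electronic_macdonald_def by blast

lemma electronic_shift:
  "\<mu> \<in> weights n \<Longrightarrow>
    E (\<lambda>i. if i \<in> {1..n} then \<mu> i - 1 else 0) = (\<Prod>i\<in>{1..n}. inverse (X i)) * E \<mu>"
  using E unfolding electronic_macdonald_def by blast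

text \<open>Induction on the sum of the entries: a positive entry is moved to the first position by
  exchanges, and undoing a rotation then lowers the sum by one.\<close>

lemma electronic_nonneg_cong:
  assumes "\<mu> \<in> weights n" "\<forall>j. 0 \<le> \<mu> j"
  shows "thalf_cong n (E \<mu>) (weight_monomial n \<mu>)"
  using assms
proof (induction "nat (\<Sum>j\<in>{1..n}. \<mu> j)" arbitrary: \<mu> rule: less_induct)
  case less
  \<comment> \<open>Inner induction on the position of a positive entry, over all weights with the
    given sum, since exchanges change the weight.\<close>
  have step: "thalf_cong n (E \<nu>) (weight_monomial n \<nu>)"
    if "1 \<le> i" "i \<le> n" "\<nu> \<in> weights n" "\<forall>j. 0 \<le> \<nu> j" "(\<Sum>j\<in>{1..n}. \<nu> j) = (\<Sum>j\<in>{1..n}. \<mu> j)" "0 < \<nu> i" for i \<nu>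
    using that
  proof (induction i arbitrary: \<nu> rule: dec_induct)
    case base
    note \<nu> = base(2,3,4,5)
    define \<kappa> where "\<kappa> i = (if i \<in> {1..<n} then \<nu> (Suc i) else if i = n then \<nu> 1 - 1 else 0)" for i
    have \<kappa>: "\<kappa> \<in> weights n" "\<forall>j. 0 \<le> \<kappa> j" and rot: "rotate_weight n \<kappa> = \<nu>"
      using n \<nu>(1,2,4) by (auto simp: weights_def \<kappa>_def rotate_weight_def fun_eq_iff Suc_le_eq)
    have "(\<Sum>j\<in>{1..n}. \<kappa> j) = \<kappa> n + (\<Sum>j\<in>{1..<n}. \<nu> (Suc j))"
    proof -
      have "{1..n} = insert n {1..<n}" using n by auto
      then show ?thesis by (simp add: \<kappa>_def)
    qed
    also have "(\<Sum>j\<in>{1..<n}. \<nu> (Suc j)) = (\<Sum>j\<in>{Suc 1..<Suc n}. \<nu> j)"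
      by (rule sum.shift_bounds_Suc_ivl[symmetric])
    also have "\<kappa> n = \<nu> 1 - 1" by (simp add: \<kappa>_def)
    finally have "(\<Sum>j\<in>{1..n}. \<kappa> j) = (\<Sum>j\<in>insert 1 {Suc 1..<Suc n}. \<nu> j) - 1"
      by simp
    also have "insert 1 {Suc 1..<Suc n} = {1..n}" using n by auto
    finally have sum: "(\<Sum>j\<in>{1..n}. \<kappa> j) = (\<Sum>j\<in>{1..n}. \<mu> j) - 1" using \<nu>(3) by simp
    \<comment> \<open>The measure is truncated by \<open>nat\<close>; this bound ensures that it
      really decreases.\<close>
    have "0 \<le> (\<Sum>j\<in>{1..n}. \<kappa> j)" using \<kappa>(2) by (simp add: sum_nonneg)
    then have "thalf_cong n (E \<kappa>) (weight_monomial n \<kappa>)"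
      using sum \<kappa> by (intro less.hyps) auto
    then have "thalf_cong n (const (q_par powi \<kappa> n) * X 1 * rotate_vars n (E \<kappa>))
        (const (q_par powi \<kappa> n) * X 1 * rotate_vars n (weight_monomial n \<kappa>))"
      using n by (intro thalf_cong_mult thalf_cong_rotate)
        (auto intro!: regular_laurents_intros regular_powi simp: regular_parameters)
    then show ?case
      using electronic_rotate[OF \<kappa>(1)] rotate_weight_monomial[OF n \<kappa>(1)] rot by simp
  next
    case (step i)
    show ?case
    proof (cases "0 < \<nu> i")
      case True
      then show ?thesis using step by simp
    next
      case False
      then have i: "i \<in> {1..<n}" and lt0: "\<nu> i < \<nu> (Suc i)"
        using step by auto
      let ?\<kappa> = "weight_act (simple_refl i) \<nu>"
      note perm = simple_refl_permutes[OF i]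
      have \<kappa>: "?\<kappa> \<in> weights n" using perm step.prems(2) by (rule weight_act_weights)
      have app: "?\<kappa> j = \<nu> (simple_refl i j)" for j by (simp add: weight_act_def)
      have sum: "(\<Sum>j\<in>{1..n}. ?\<kappa> j) = (\<Sum>j\<in>{1..n}. \<nu> j)"
        unfolding app by (rule sum.reindex_bij_betw[OF permutes_imp_bij[OF perm]])
      have nonneg: "\<forall>j. 0 \<le> ?\<kappa> j" using step.prems by (simp only: app simp_thms)
      have swap: "?\<kappa> i = \<nu> (Suc i)" "?\<kappa> (Suc i) = \<nu> i"
        unfolding app by (simp_all add: simple_refl_apply)
      \<comment> \<open>The exchange rule leads away from a descent, so it is applied to the swapped
        weight and yields E at the weight wanted.\<close>
      have lt: "?\<kappa> (Suc i) < ?\<kappa> i" unfolding swap by (rule lt0)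
      have cong: "thalf_cong n (E ?\<kappa>) (weight_monomial n ?\<kappa>)"
      proof (rule step.IH[OF _ \<kappa> nonneg])
        show "i \<le> n" using i by simp
        show "sum ?\<kappa> {1..n} = sum \<mu> {1..n}" using sum step.prems by simp
        show "0 < ?\<kappa> i" unfolding swap using step.prems by simp
      qed
      have undo: "weight_act (simple_refl i) ?\<kappa> = \<nu>"
        by (simp add: fun_eq_iff weight_act_def)
      have "E \<nu> = divided_diff i (X i * E ?\<kappa>) - const t_par * X i * divided_diff i (E ?\<kappa>) +
          const ((1 - t_par) * exchange_par n ?\<kappa> i / (1 - exchange_par n ?\<kappa> i)) * E ?\<kappa>"
        using electronic_exchange[OF \<kappa> i nonneg lt] unfolding undo .
      moreover have "perm_act (simple_refl i) (weight_monomial n ?\<kappa>) = weight_monomial n \<nu>"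
        by (simp add: perm_act_weight_monomial[OF perm] undo)
      ultimately show ?thesis
        using thalf_cong_exchange[OF i cong weight_monomial_regular lt] by (simp only:)
    qed
  qed
  show ?case
  proof (cases "\<exists>i\<in>{1..n}. 0 < \<mu> i")
    case True
    then show ?thesis using step[OF _ _ less.prems] by auto
  next
    case False
    have "\<mu> j = 0" for j
      using False less.prems by (cases "j \<in> {1..n}") (auto simp: weights_def not_less intro: antisym)
    then have "\<mu> = (\<lambda>_. 0)" by auto
    then show ?thesis by (simp add: electronic_zero weight_monomial_def thalf_cong_refl)
  qed
qed

text \<open>Adding 1 to all entries corresponds to multiplying by x_1...x_n for E and for monomials
  alike; k bounds the number of shifts needed to reach nonnegative entries.\<close>

lemma electronic_cong:
  assumes "\<mu> \<in> weights n"
  shows "thalf_cong n (E \<mu>) (weight_monomial n \<mu>)"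
proof -
  have shifted: "thalf_cong n (E \<mu>) (weight_monomial n \<mu>)"
    if "\<mu> \<in> weights n" "\<forall>j\<in>{1..n}. 0 \<le> \<mu> j + int k" for k \<mu>
    using that
  proof (induction k arbitrary: \<mu>)
    case 0
    have "0 \<le> \<mu> j" for j using 0 by (cases "j \<in> {1..n}") (auto simp: weights_def)
    then show ?case using 0 by (intro electronic_nonneg_cong) auto
  next
    case (Suc k)
    define \<nu> where "\<nu> i = (if i \<in> {1..n} then \<mu> i + 1 else 0)" for i
    have \<nu>: "\<nu> \<in> weights n" by (auto simp: weights_def \<nu>_def)
    have \<mu>: "(\<lambda>i. if i \<in> {1..n} then \<nu> i - 1 else 0) = \<mu>"
      using Suc.prems(1) by (auto simp: fun_eq_iff \<nu>_def weights_def)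
    have "(\<Prod>i\<in>{1..n}. inverse (X i)) * weight_monomial n \<nu> = weight_monomial n \<mu>"
      unfolding weight_monomial_def prod.distrib[symmetric]
      by (rule prod.cong) (auto simp: \<nu>_def power_int_add)
    moreover have "thalf_cong n ((\<Prod>i\<in>{1..n}. inverse (X i)) * E \<nu>)
        ((\<Prod>i\<in>{1..n}. inverse (X i)) * weight_monomial n \<nu>)"
    proof (intro thalf_cong_mult Suc.IH[OF \<nu>] regular_laurents_prod regular_laurents.inverse_X)
      show "\<forall>j\<in>{1..n}. 0 \<le> \<nu> j + int k"
        using Suc.prems(2) by (auto simp: \<nu>_def algebra_simps)
    qed
    ultimately show ?case using electronic_shift[OF \<nu>] \<mu> by simp
  qed
  have "0 \<le> \<mu> j + int (nat (\<Sum>i\<in>{1..n}. \<bar>\<mu> i\<bar>))" if "j \<in> {1..n}" for j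
  proof -
    have "\<bar>\<mu> j\<bar> \<le> (\<Sum>i\<in>{1..n}. \<bar>\<mu> i\<bar>)" using that by (intro member_le_sum) auto
    then show ?thesis by linarith
  qed
  then show ?thesis
    using shifted[OF assms, of "nat (\<Sum>i\<in>{1..n}. \<bar>\<mu> i\<bar>)"] by blast
qed

text \<open>The definition of \<open>bosonic_sum\<close> has denominators x_i - x_j outside the
  regular Laurent polynomials. Its Hecke form avoids them, and each scaled T_w reduces to w.\<close>

lemma bosonic_sum_cong:
  assumes "\<mu> \<in> weights n"
  shows "thalf_cong n (bosonic_sum n E \<mu>) (\<Sum>w | w permutes {1..n}. weight_monomial n (weight_act w \<mu>))"
proof -
  define ws where "ws w = (SOME is. reduced_word n w is)" for w
  have ws: "set (ws w) \<subseteq> {1..<n}" "word_perm (ws w) = w" "length (ws w) = perm_length n w"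
    if "w permutes {1..n}" for w
  proof -
    have "reduced_word n w (ws w)" unfolding ws_def by (rule some_reduced_word[OF that])
    then show "set (ws w) \<subseteq> {1..<n}" "word_perm (ws w) = w" "length (ws w) = perm_length n w"
      by (auto simp: reduced_word_def)
  qed
  have "bosonic_sum n E \<mu> =
      (\<Sum>w | w permutes {1..n}. const (1 ^ perm_length n w * thalf ^ perm_length n w) * hecke_perm n w (E \<mu>))"
    unfolding bosonic_sum_eq_symmetrizer bosonic_symmetrizer_def sum_distrib_left
    by (simp add: power_int_diff_nat flip: const_mult mult.assoc)
  also have "\<dots> = (\<Sum>w | w permutes {1..n}. foldr (\<lambda>i f. const thalf * hecke i f) (ws w) (E \<mu>))"
    by (rule sum.cong) (auto simp: scaled_hecke_word hecke_perm_def ws(3) simp flip: ws_def)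
  finally show ?thesis
    using ws thalf_cong_hecke_word[OF _ electronic_cong[OF assms] weight_monomial_regular]
    by (auto intro!: thalf_cong_sum simp flip: perm_act_weight_monomial) (metis ws(1,2))
qed

end

section \<open>The normalizing constant\<close>

lemma lookup_single_0_mult:
  fixes f :: laurent
  shows "Poly_Mapping.lookup (Poly_Mapping.single 0 c * f) m = c * Poly_Mapping.lookup f m"
  by (simp add: mult_map_scale_conv_mult[symmetric] Poly_Mapping.map.rep_eq when_def)

lemma has_coeff_const_mult:
  assumes keys: "\<forall>m\<in>Poly_Mapping.keys f. Poly_Mapping.keys m \<subseteq> {1..n}"
  shows "has_coeff n (const c * of_laurent f) \<mu> d \<longleftrightarrow> c * Poly_Mapping.lookup f (Abs_poly_mapping \<mu>) = d"
proof -
  have eq: "const c * of_laurent f = of_laurent (Poly_Mapping.single 0 c * f)"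
    by (simp add: const_def of_laurent_mult)
  have "Poly_Mapping.keys (Poly_Mapping.single 0 c * f) \<subseteq> Poly_Mapping.keys f"
    by (auto simp: in_keys_iff lookup_single_0_mult)
  then have "of_laurent (Poly_Mapping.single 0 c * f) \<in> laurent_polys n"
    unfolding laurent_polys_def using keys by blast
  then show ?thesis
    unfolding has_coeff_def eq of_laurent_inject by (auto simp: lookup_single_0_mult)
qed

lemma bosonic_sum_coeff:
  assumes "1 \<le> n" "electronic_macdonald n E" and \<mu>: "\<mu> \<in> weights n"
  shows "\<exists>f. bosonic_sum n E \<mu> = of_laurent f \<and> (\<forall>m\<in>Poly_Mapping.keys f. Poly_Mapping.keys m \<subseteq> {1..n}) \<and>
    Poly_Mapping.lookup f (Abs_poly_mapping \<mu>) \<noteq> 0"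
proof -
  let ?P = "{w. w permutes {1..n}}" and ?M = "\<lambda>w. Abs_poly_mapping (weight_act w \<mu>)"
  have cong: "thalf_cong n (bosonic_sum n E \<mu>) (\<Sum>w\<in>?P. weight_monomial n (weight_act w \<mu>))"
    using assms by (rule bosonic_sum_cong)
  then obtain u where u: "u \<in> regular_laurents n"
    "bosonic_sum n E \<mu> = (\<Sum>w\<in>?P. weight_monomial n (weight_act w \<mu>)) + const (thalf - 1) * u"
    unfolding thalf_cong_def by blast
  have "bosonic_sum n E \<mu> \<in> regular_laurents n"
    using cong by (rule thalf_cong_regular) (simp add: regular_laurents_sum)
  then obtain f where f: "bosonic_sum n E \<mu> = of_laurent f"
    "\<forall>m\<in>Poly_Mapping.keys f. Poly_Mapping.keys m \<subseteq> {1..n}"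
    using regular_laurents_lookup by blast
  obtain h where h: "u = of_laurent h" "\<forall>m. Poly_Mapping.lookup h m \<in> regular"
    using regular_laurents_lookup[OF u(1)] by blast
  have "(\<Sum>w\<in>?P. weight_monomial n (weight_act w \<mu>)) =
      of_laurent (\<Sum>w\<in>?P. Poly_Mapping.single (?M w) 1)"
    unfolding of_laurent_sum
    by (rule sum.cong) (auto intro!: weight_monomial_of_laurent weight_act_weights \<mu>)
  then have "of_laurent f = of_laurent ((\<Sum>w\<in>?P. Poly_Mapping.single (?M w) 1) + Poly_Mapping.single 0 (thalf - 1) * h)"
    using u(2) f(1) h(1) by (simp add: of_laurent_add of_laurent_mult const_def)
  then have "f = (\<Sum>w\<in>?P. Poly_Mapping.single (?M w) 1) + Poly_Mapping.single 0 (thalf - 1) * h"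
    by (simp only: of_laurent_inject)
  then have "Poly_Mapping.lookup f (Abs_poly_mapping \<mu>) =
      (\<Sum>w\<in>?P. if ?M w = Abs_poly_mapping \<mu> then 1 else 0) + (thalf - 1) * Poly_Mapping.lookup h (Abs_poly_mapping \<mu>)"
    by (simp add: lookup_add lookup_sum lookup_single when_def lookup_single_0_mult)
  also have "(\<Sum>w\<in>?P. if ?M w = Abs_poly_mapping \<mu> then 1 else 0 :: coeff_field) =
      of_nat (card {w\<in>?P. ?M w = Abs_poly_mapping \<mu>})"
    by (simp add: sum.If_cases finite_permutations Int_def)
  finally have lookup: "Poly_Mapping.lookup f (Abs_poly_mapping \<mu>) =
      of_nat (card {w\<in>?P. ?M w = Abs_poly_mapping \<mu>}) + (thalf - 1) * Poly_Mapping.lookup h (Abs_poly_mapping \<mu>)" .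
  \<comment> \<open>The count is the order of the stabilizer of \<mu>, positive because of the
    identity.\<close>
  have "weight_act id \<mu> = \<mu>" by (simp add: weight_act_def)
  then have "id \<in> {w\<in>?P. ?M w = Abs_poly_mapping \<mu>}" by (simp add: permutes_id del: id_apply)
  moreover have "finite {w\<in>?P. ?M w = Abs_poly_mapping \<mu>}" by (simp add: finite_permutations)
  ultimately have "0 < card {w\<in>?P. ?M w = Abs_poly_mapping \<mu>}"
    unfolding card_gt_0_iff by blast
  then have "Poly_Mapping.lookup f (Abs_poly_mapping \<mu>) \<noteq> 0"
    unfolding lookup using h(2) by (intro of_nat_plus_regular_nonzero) auto
  with f show ?thesis by blast
qed

lemma bosonic_macdonald_has_coeff:
  assumes "1 \<le> n" "electronic_macdonald n E" "\<mu> \<in> weights n"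
  shows "has_coeff n (bosonic_macdonald n E \<mu>) \<mu> 1"
proof -
  obtain f where f: "bosonic_sum n E \<mu> = of_laurent f" "\<forall>m\<in>Poly_Mapping.keys f. Poly_Mapping.keys m \<subseteq> {1..n}"
    and nz: "Poly_Mapping.lookup f (Abs_poly_mapping \<mu>) \<noteq> 0"
    using bosonic_sum_coeff[OF assms] by blast
  \<comment> \<open>At c = 0 the scaled sum is 0 and has no coefficient 1, so the definite
    description has exactly one solution, the actual coefficient.\<close>
  have iff: "has_coeff n (const (1 / c) * bosonic_sum n E \<mu>) \<mu> 1 \<longleftrightarrow>
      c = Poly_Mapping.lookup f (Abs_poly_mapping \<mu>)" for c
    unfolding f(1) has_coeff_const_mult[OF f(2)] using nz by (cases "c = 0") (auto simp: field_simps)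
  then have "normalizing_const n E \<mu> = Poly_Mapping.lookup f (Abs_poly_mapping \<mu>)"
    unfolding normalizing_const_def by simp
  then show ?thesis unfolding bosonic_macdonald_def iff .
qed

theorem theorem4p3:
  fixes n :: nat and E :: "(nat \<Rightarrow> int) \<Rightarrow> ratfun" and lam :: "nat \<Rightarrow> int"
  assumes "n \<ge> 1"
    and "electronic_macdonald n E"
    and "lam \<in> weights n"
    and "\<forall>i \<in> {1..<n}. lam i \<ge> lam (Suc i)"
  shows "has_coeff n (bosonic_macdonald n E lam) lam 1 \<and>
    bosonic_macdonald n E lam =
      const (thalf ^ perm_length n (longest n) / normalizing_const n E lam) *
      bosonic_symmetrizer n (E lam) \<and>
    fermionic_macdonald n E (\<lambda>i. lam i + rho n i) =
      const (thalf ^ perm_length n (longest n)) *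
      fermionic_symmetrizer n (E (\<lambda>i. lam i + rho n i))"
proof (intro conjI)
  show "has_coeff n (bosonic_macdonald n E lam) lam 1"
    using assms(1-3) by (rule bosonic_macdonald_has_coeff)
  show "bosonic_macdonald n E lam =
      const (thalf ^ perm_length n (longest n) / normalizing_const n E lam) *
      bosonic_symmetrizer n (E lam)"
    by (simp add: bosonic_macdonald_def bosonic_sum_eq_symmetrizer flip: const_mult mult.assoc)
  show "fermionic_macdonald n E (\<lambda>i. lam i + rho n i) =
      const (thalf ^ perm_length n (longest n)) *
      fermionic_symmetrizer n (E (\<lambda>i. lam i + rho n i))"
    by (rule fermionic_macdonald_eq_symmetrizer)
qed

end
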